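(* Let $K$ be a non-archimedean field of residue characteristic $p\geq 0$, and let $\phi\in K(z)$ be a rational function of degree $d\geq 2$ with a totally invariant type II point $\xi\in\mathbb{P}^1_{\mathrm{Berk}}$. Let $e=v_p(d)\geq 0$, and let $U$ be an attracting fixed component of $\mathbb{P}^1_{\mathrm{Berk}}\setminus\{\xi\}$ such that $U\cap\mathbb{P}^1(K)\neq\varnothing$. Then there is a point $\alpha\in\mathbb{P}^1(\overline{K})\setminus U$ such that $[K(\alpha):K]\leq p^e$.
   Context: $K$ is a field, $\overline{K}$ an algebraic closure, $|\cdot|$ a non-archimedean absolute value on $\overline{K}$, $\mathbb{C}_v$ the completion of $\overline{K}$; $p$ is the residue characteristic of $K$. For prime $p$, $v_p(n)$ is the largest $e$ with $p^e\mid n$; if $p=0$, $v_p(n)=0$ and $p^0=1$. $\mathbb{P}^1_{\mathrm{Berk}}$ is the Berkovich projective line over $\mathbb{C}_v$, a compact Hausdorff uniquely path-connected space containing $\mathbb{P}^1(\mathbb{C}_v)$, with a point $\zeta(a,r)$ for each closed disk $\bar D(a,r)\subseteq\mathbb{C}_v$, type II when $r\in|\mathbb{C}_v^\times|$; the components of $\mathbb{P}^1_{\mathrm{Berk}}\setminus\{\zeta(a,r)\}$ meet $\mathbb{P}^1(\mathbb{C}_v)$ in $\mathbb{P}^1(\mathbb{C}_v)\setminus\bar D(a,r)$ and in the open disks $D(b,r)$, $b\in\bar D(a,r)$. Rational functions extend uniquely to continuous self-maps of $\mathbb{P}^1_{\mathrm{Berk}}$. $\xi$ is totally invariant if $\phi^{-1}(\xi)=\{\xi\}$.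 A component $U$ of $\mathbb{P}^1_{\mathrm{Berk}}\setminus\{\xi\}$ is fixed if $\phi(U)\subseteq U$; a fixed component is indifferent if $\phi:U\to U$ is one-to-one, attracting otherwise. *)

theory Defs
  imports
    "HOL-Analysis.Analysis"
    "HOL-Algebra.Algebraic_Closure_Type"
    "HOL-Algebra.Generated_Fields"
begin

abbreviation Cring :: "'c::field ring" where
  "Cring \<equiv> ring_of_type_algebra"

text \<open>The type \<^typ>\<open>'c\<close> plays the role of \<open>\<complex>\<^sub>v\<close>: it is complete for the absolute value \<open>v\<close> and
  contains an algebraic closure \<open>Kbar\<close> of the subfield \<open>K\<close> as a dense subset. The absolute values
  on \<open>K\<close> and \<open>Kbar\<close> are the restrictions of \<open>v\<close>; they may be trivial.\<close>

locale nonarch_field =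
  fixes v :: "'c::field \<Rightarrow> real" and K Kbar :: "'c set"
  assumes v_nonneg: "0 \<le> v x"
    and v_eq_0_iff: "v x = 0 \<longleftrightarrow> x = 0"
    and v_mult: "v (x * y) = v x * v y"
    and v_ultrametric: "v (x + y) \<le> max (v x) (v y)"
    and algebraic_closure: "algebraic_closure (Cring\<lparr>carrier := Kbar\<rparr>) K"
    and Kbar_dense: "Metric_space.mtopology UNIV (\<lambda>x y. v (x - y)) closure_of Kbar = UNIV"
    and complete: "Metric_space.mcomplete UNIV (\<lambda>x y. v (x - y))"

definition residue_field :: "('c::field \<Rightarrow> real) \<Rightarrow> 'c set \<Rightarrow> 'c set ring" where
  "residue_field v K = (Cring\<lparr>carrier := {x \<in> K. v x \<le> 1}\<rparr>) Quot {x \<in> K. v x < 1}"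

text \<open>The characteristic of a ring is the additive order of its unit element; \<^const>\<open>group.ord\<close>
  returns 0 for elements of infinite order.\<close>

definition residue_char :: "('c::field \<Rightarrow> real) \<Rightarrow> 'c set \<Rightarrow> nat" where
  "residue_char v K = group.ord (add_monoid (residue_field v K)) \<one>\<^bsub>residue_field v K\<^esub>"

text \<open>The projective line over \<^typ>\<open>'c\<close> is \<^typ>\<open>'c option\<close>, with \<^const>\<open>None\<close> the point at infinity.\<close>

definition proj_line :: "'c set \<Rightarrow> 'c option set" where
  "proj_line F = insert None (Some ` F)"

definition field_of_def :: "'c::field set \<Rightarrow> 'c option \<Rightarrow> 'c set" where
  "field_of_def K \<alpha> = generate_field Cring (K \<union> set_option \<alpha>)"

definition degree_le :: "'c::field set \<Rightarrow> 'c option \<Rightarrow> nat \<Rightarrow> bool" where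
  "degree_le K \<alpha> m \<longleftrightarrow> (\<exists>n\<le>m. ring.dimension Cring n K (field_of_def K \<alpha>))"

text \<open>The Berkovich affine line: multiplicative seminorms on the polynomial ring that extend \<open>v\<close>,
  with the topology of pointwise convergence. It is locally compact Hausdorff, and the projective
  line is its one-point compactification, the added point \<^const>\<open>None\<close> being infinity.\<close>

definition A1_Berk :: "('c::field \<Rightarrow> real) \<Rightarrow> ('c poly \<Rightarrow> real) set" where
  "A1_Berk v = {x. (\<forall>c. x [:c:] = v c) \<and> (\<forall>f g. x (f * g) = x f * x g) \<and>
                   (\<forall>f g. x (f + g) \<le> max (x f) (x g))}"

definition P1_Berk :: "('c::field \<Rightarrow> real) \<Rightarrow> ('c poly \<Rightarrow> real) option topology" where
  "P1_Berk v = Alexandroff_compactification (subtopology (powertop_real UNIV) (A1_Berk v))"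

text \<open>The point \<open>\<zeta>(a,r)\<close> of a closed disk is the supremum seminorm on that disk.\<close>

definition zeta :: "('c::field \<Rightarrow> real) \<Rightarrow> 'c \<Rightarrow> real \<Rightarrow> 'c poly \<Rightarrow> real" where
  "zeta v a r = (\<lambda>f. SUP z\<in>{z. v (z - a) \<le> r}. v (poly f z))"

definition type_I :: "('c::field \<Rightarrow> real) \<Rightarrow> 'c option \<Rightarrow> ('c poly \<Rightarrow> real) option" where
  "type_I v = map_option (\<lambda>a f. v (poly f a))"

definition is_type_II :: "('c::field \<Rightarrow> real) \<Rightarrow> ('c poly \<Rightarrow> real) option \<Rightarrow> bool" where
  "is_type_II v \<xi> \<longleftrightarrow> (\<exists>a c. c \<noteq> 0 \<and> \<xi> = Some (zeta v a (v c)))"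

text \<open>A rational function is given in lowest terms, as \<open>P / Q\<close> with \<open>P\<close> and \<open>Q\<close> coprime.\<close>

definition rat_degree :: "'c::field poly \<Rightarrow> 'c poly \<Rightarrow> nat" where
  "rat_degree P Q = max (Polynomial.degree P) (Polynomial.degree Q)"

text \<open>Numerator of \<open>f \<circ> (P / Q)\<close> over the denominator \<open>Q ^ degree f\<close>.\<close>

definition comp_num :: "'c::field poly \<Rightarrow> 'c poly \<Rightarrow> 'c poly \<Rightarrow> 'c poly" where
  "comp_num P Q f = (\<Sum>i\<le>Polynomial.degree f.
      Polynomial.smult (Polynomial.coeff f i) (P ^ i * Q ^ (Polynomial.degree f - i)))"

text \<open>The value of \<open>P / Q\<close> at infinity, as a point of the projective line.\<close>

definition rat_at_infinity :: "'c::field poly \<Rightarrow> 'c poly \<Rightarrow> 'c option" where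
  "rat_at_infinity P Q =
    (if Polynomial.degree Q < Polynomial.degree P then None
     else Some (Polynomial.coeff P (Polynomial.degree Q) / Polynomial.coeff Q (Polynomial.degree Q)))"

text \<open>The extension of \<open>\<phi> = P / Q\<close> to the Berkovich line sends the seminorm \<open>x\<close> to
  \<open>f \<mapsto> x (f \<circ> \<phi>)\<close>, where \<open>x\<close> is extended multiplicatively to fractions; if \<open>x Q = 0\<close>, then \<open>x\<close> is a
  pole of \<open>\<phi>\<close>.\<close>

definition berk_map ::
  "('c::field \<Rightarrow> real) \<Rightarrow> 'c poly \<Rightarrow> 'c poly \<Rightarrow> ('c poly \<Rightarrow> real) option \<Rightarrow> ('c poly \<Rightarrow> real) option" where
  "berk_map v P Q y = (case y of
      None \<Rightarrow> type_I v (rat_at_infinity P Q)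
    | Some x \<Rightarrow> if x Q = 0 then None
                else Some (\<lambda>f. x (comp_num P Q f) / x Q ^ Polynomial.degree f))"

definition totally_invariant ::
  "('c::field \<Rightarrow> real) \<Rightarrow> 'c poly \<Rightarrow> 'c poly \<Rightarrow> ('c poly \<Rightarrow> real) option \<Rightarrow> bool" where
  "totally_invariant v P Q \<xi> \<longleftrightarrow> {y \<in> topspace (P1_Berk v). berk_map v P Q y = \<xi>} = {\<xi>}"

definition complement_components ::
  "('c::field \<Rightarrow> real) \<Rightarrow> ('c poly \<Rightarrow> real) option \<Rightarrow> ('c poly \<Rightarrow> real) option set set" where
  "complement_components v \<xi> =
    connected_components_of (subtopology (P1_Berk v) (topspace (P1_Berk v) - {\<xi>}))"

definition attracting_fixed_component ::
  "('c::field \<Rightarrow> real) \<Rightarrow> 'c poly \<Rightarrow> 'c poly \<Rightarrow> ('c poly \<Rightarrow> real) option \<Rightarrow>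
    ('c poly \<Rightarrow> real) option set \<Rightarrow> bool" where
  "attracting_fixed_component v P Q \<xi> U \<longleftrightarrow>
    U \<in> complement_components v \<xi> \<and> berk_map v P Q ` U \<subseteq> U \<and> \<not> inj_on (berk_map v P Q) U"

end

theory Submission
  imports Defs "HOL-Algebra.Exponent"
begin

text \<open>If \<open>\<infinity> \<notin> U\<close>, take \<open>\<alpha> = \<infinity>\<close>. Otherwise \<open>\<xi> = \<zeta>(a,r)\<close> and \<open>U\<close> lies outside the closed disk
  \<open>D\<close> of \<open>\<xi>\<close>. As \<open>\<xi>\<close> and \<open>U\<close> are fixed and \<open>U\<close> is attracting, the leading coefficients of \<open>P / Q\<close>
  at \<open>(a,r)\<close> show that \<open>P - z Q\<close> has one root in \<open>U\<close> and \<open>d\<close> roots in \<open>D\<close>; dividing out an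
  approximation in \<open>K\<close> of the former gives a polynomial over \<open>K\<close> of degree \<open>d\<close> with all roots in
  \<open>D\<close>. Since \<open>d choose p ^ e\<close> is prime to \<open>p\<close>, its divided derivative of order \<open>d - p ^ e\<close> is a
  polynomial of degree \<open>p ^ e\<close> with all roots in \<open>D\<close>.\<close>

section \<open>Subfields of a field type\<close>

text \<open>In the coordinate \<open>u = (z - a) / c\<close> the map is \<open>A / B\<close>, where
  \<open>A\<close> and \<open>B\<close> have the same Gauss norm M because \<xi> is fixed. Write A_i
  and B_i for their coefficients. That U is mapped into itself gives |A_d| = M > |B_d|: the
  reduction of \<open>A / B\<close> fixes infinity, and its multiplier there is the reduction of
  B_(d-1) / A_d. Were this nonzero, the map would be injective on the whole direction of infinity,
  so attracting means |B_(d-1)| < M. In \<open>A - u B\<close> the coefficient of u^(d+1) is -B_d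
  and that of u^d is A_d - B_(d-1), of size M; this is where the count of one root outside and d
  roots inside comes from. For the polynomials constructed over \<open>K\<close>, having all roots
  in the disk is carried by a condition on coefficients: in the coordinate \<open>u\<close>, the top
  coefficient has maximal absolute value. This condition tolerates the remainder of the division,
  and it survives a divided derivative as long as the binomial coefficient at the top is a unit. The
  number p^e is the least q >= 1 for which \<open>d choose q\<close> is prime to p; it is 1 if p =
  0.\<close>

lemma Cring_simps [simp]:
  "carrier (Cring :: 'c::field ring) = UNIV"
  "\<zero>\<^bsub>Cring\<^esub> = (0 :: 'c)" "\<one>\<^bsub>Cring\<^esub> = (1 :: 'c)"
  "x \<oplus>\<^bsub>Cring\<^esub> y = (x + y :: 'c)" "x \<otimes>\<^bsub>Cring\<^esub> y = (x * y :: 'c)"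
  by (simp_all add: ring_of_type_algebra_def)

text \<open>Bridge between two kinds of polynomials: in \<open>HOL-Algebra\<close> they are lists
  with the leading coefficient first, so \<open>rev (coeffs f)\<close> represents \<open>f\<close>
  there.\<close>

lemma Cring_eval: "ring.eval (Cring :: 'c::field ring) (rev (coeffs f)) x = poly f x"
proof -
  interpret R: field "Cring :: 'c ring" by rule
  show ?thesis
  proof (induction f)
    case (pCons a f)
    show ?case
    proof (cases "f = 0 \<and> a = 0")
      case True thus ?thesis by simp
    next
      case False
      then have "rev (coeffs (pCons a f)) = rev (coeffs f) @ [a]"
        by (auto simp: coeffs_pCons_eq_cCons cCons_def)
      thus ?thesis using pCons.IH
        by (simp add: R.eval_append_aux algebra_simps)
    qed
  qed simp
qed

lemma Cring_inv: "x \<noteq> 0 \<Longrightarrow> inv\<^bsub>Cring\<^esub> x = inverse (x :: 'c::field)"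
proof -
  assume "x \<noteq> 0"
  interpret R: field "Cring :: 'c ring" by rule
  show ?thesis by (rule R.comm_inv_char) (use \<open>x \<noteq> 0\<close> in auto)
qed

lemma Cring_a_inv: "\<ominus>\<^bsub>Cring\<^esub> x = - (x :: 'c::field)"
proof -
  interpret R: field "Cring :: 'c ring" by rule
  show ?thesis by (rule R.minus_equality) auto
qed

definition coeffs_in :: "'c::zero set \<Rightarrow> 'c poly \<Rightarrow> bool" where
  "coeffs_in S f \<longleftrightarrow> (\<forall>i. Polynomial.coeff f i \<in> S)"

lemma coeffs_in_carrier:
  fixes f :: "'c::field poly"
  assumes "coeffs_in S f"
  shows "rev (coeffs f) \<in> carrier (univ_poly Cring S)"
proof -
  have "set (coeffs f) \<subseteq> S"
    using assms by (auto simp: coeffs_in_def coeffs_def)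
  thus ?thesis
    unfolding univ_poly_def polynomial_def by (auto simp: hd_rev last_coeffs_eq_coeff_degree)
qed

text \<open>The minimal polynomial of \<alpha> divides \<open>f\<close>, and its degree is the
  dimension of the simple extension. As \<alpha> is algebraic, that extension is a field, hence the
  field generated by \<alpha>.\<close>

lemma degree_le_root:
  assumes K: "subfield K (Cring :: 'c::field ring)"
    and f: "coeffs_in K f" "f \<noteq> 0" "poly f \<alpha> = 0" and n: "Polynomial.degree f \<le> n"
  shows "degree_le K (Some \<alpha>) n"
proof -
  interpret R: field "Cring :: 'c ring" by rule
  interpret K: subfield K "Cring :: 'c ring" by (rule K)
  let ?p = "rev (coeffs f)"
  have p: "?p \<in> carrier (univ_poly Cring K)" using coeffs_in_carrier f(1) by blast
  have ne: "?p \<noteq> []" using f by simp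
  have ev: "R.eval ?p \<alpha> = 0" using f by (simp add: Cring_eval)
  have alg: "(R.algebraic over K) \<alpha>" using R.algebraicI[OF p ne] ev by simp
  have sub: "subring K Cring" using K subfieldE(1) by blast
  let ?E = "R.simple_extension K \<alpha>"
  have "Polynomials.degree (R.Irr K \<alpha>) \<le> Polynomials.degree ?p"
    using R.pdivides_imp_degree_le[OF sub R.IrrE(1)[OF K _ alg] p ne]
      R.Irr_minimal[OF K _ alg p] ev by simp
  also have "\<dots> \<le> n" using n f by (simp add: length_coeffs_degree)
  finally have le: "Polynomials.degree (R.Irr K \<alpha>) \<le> n" .
  have fld: "subfield ?E Cring" using R.simple_extension_is_subfield[OF K] alg by simp
  have "generate_field Cring (K \<union> {\<alpha>}) = ?E"
  proof (rule antisym)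
    show "generate_field Cring (K \<union> {\<alpha>}) \<subseteq> ?E"
      using R.simple_extension_incl[of K \<alpha>] R.simple_extension_mem[OF sub, of \<alpha>]
      by (intro R.generate_field_min_subfield1[OF _ fld]) auto
    show "?E \<subseteq> generate_field Cring (K \<union> {\<alpha>})"
      by (intro R.simple_extension_subring_incl subfieldE(1) R.generate_field_is_subfield)
        (auto intro: generate_field.incl)
  qed
  moreover have "R.dimension (Polynomials.degree (R.Irr K \<alpha>)) K ?E"
    by (rule R.dimension_simple_extension[OF K _ alg]) simp
  ultimately show ?thesis
    using le unfolding degree_le_def field_of_def_def by auto
qed

lemma degree_le_infinity:
  assumes K: "subfield K (Cring :: 'c::field ring)" and "1 \<le> n"
  shows "degree_le K None n"
proof -
  interpret R: field "Cring :: 'c ring" by rule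
  have "generate_field Cring K = K"
    using R.generate_field_min_subfield1[OF _ K, of K] by (auto intro: generate_field.incl)
  moreover have "R.dimension 1 K K" by (rule R.dimension_one[OF K])
  ultimately show ?thesis
    using assms(2) unfolding degree_le_def field_of_def_def by auto
qed

text \<open>The locale \<open>algebraic_closure\<close> speaks of a ring whose carrier is cut down
  to \<open>Kb\<close>. Evaluation and subfields do not depend on this restriction, so its
  conclusions transfer to the full type; from then on only roots in \<open>Kb\<close>
  matter.\<close>

lemma algebraic_closure_facts:
  assumes "algebraic_closure ((Cring :: 'c::field ring)\<lparr>carrier := Kb\<rparr>) K"
  shows "subfield Kb (Cring :: 'c ring)" "subfield K (Cring :: 'c ring)" "K \<subseteq> Kb"
    "\<lbrakk>coeffs_in Kb f; 0 < Polynomial.degree f\<rbrakk> \<Longrightarrow> \<exists>z\<in>Kb. poly f z = 0"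
proof -
  interpret R: field "Cring :: 'c ring" by rule
  interpret L: algebraic_closure "(Cring :: 'c ring)\<lparr>carrier := Kb\<rparr>" K by fact
  show Kb: "subfield Kb (Cring :: 'c ring)"
    using R.subfield_iff(1)[of Kb] L.field_axioms by simp
  then have sub: "subring Kb (Cring :: 'c ring)" using subfieldE by blast
  show KKb: "K \<subseteq> Kb" using L.subset by simp
  show "subfield K (Cring :: 'c ring)"
    using R.subfield_iff(1)[of K] L.subfield_iff(2)[OF L.subfield_axioms] by simp
  assume f: "coeffs_in Kb f" "0 < Polynomial.degree f"
  let ?p = "rev (coeffs f)"
  have "?p \<in> carrier (univ_poly Cring Kb)" using coeffs_in_carrier f(1) by blast
  then have p: "?p \<in> carrier (poly_ring ((Cring :: 'c ring)\<lparr>carrier := Kb\<rparr>))"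
    using R.univ_poly_consistent[OF sub] by simp
  have "L.splitted ?p" using L.roots_over_carrier[OF p] .
  moreover have "Polynomials.degree ?p > 0" using f(2) by (cases "f = 0") (auto simp: length_coeffs_degree)
  ultimately have "L.roots ?p \<noteq> {#}" unfolding L.splitted_def by auto
  then obtain z where "z \<in># L.roots ?p" by auto
  then have "L.is_root ?p z" using L.roots_mem_iff_is_root[OF p] by simp
  then have "z \<in> Kb" "L.eval ?p z = 0" by (auto simp: L.is_root_def)
  then have "poly f z = 0" using R.eval_consistent[OF sub] by (simp add: Cring_eval)
  with \<open>z \<in> Kb\<close> show "\<exists>z\<in>Kb. poly f z = 0" by blast
qed

section \<open>Non-archimedean absolute values and the residue characteristic\<close>

locale nonarch_abs =
  fixes v :: "'c::field \<Rightarrow> real"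
  assumes v_nonneg [simp]: "0 \<le> v x"
    and v_eq_0_iff [simp]: "v x = 0 \<longleftrightarrow> x = 0"
    and v_mult: "v (x * y) = v x * v y"
    and v_ultrametric: "v (x + y) \<le> max (v x) (v y)"
begin

lemma v_0 [simp]: "v 0 = 0" by simp

lemma v_pos: "x \<noteq> 0 \<Longrightarrow> 0 < v x"
  using v_nonneg[of x] v_eq_0_iff[of x] by linarith

lemma v_1 [simp]: "v 1 = 1"
  using v_mult[of 1 1] v_pos[of 1] by simp

lemma v_minus [simp]: "v (- x) = v x"
proof -
  have "v (- 1) * v (- 1) = 1" using v_mult[of "-1" "-1"] by simp
  then have "v (- 1) = 1" using v_nonneg[of "-1"]
    by (metis abs_of_nonneg abs_1 power2_eq_square power2_eq_1_iff abs_minus)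
  then show ?thesis using v_mult[of "-1" x] by simp
qed

lemma v_minus_commute: "v (x - y) = v (y - x)"
  using v_minus[of "x - y"] by simp

lemma v_diff_le: "v (x - y) \<le> max (v x) (v y)"
  using v_ultrametric[of x "- y"] by simp

lemma v_add_eq: "v x < v y \<Longrightarrow> v (x + y) = v y"
  using v_ultrametric[of x y] v_diff_le[of "x + y" x] by (simp add: max_def split: if_splits)

lemma v_diff_eq: "v x < v y \<Longrightarrow> v (x - y) = v y"
  using v_add_eq[of x "- y"] by simp

lemma v_power: "v (x ^ n) = v x ^ n"
  by (induction n) (simp_all add: v_mult)

lemma v_inverse: "v (inverse x) = inverse (v x)"
  using v_mult[of x "inverse x"] by (cases "x = 0") (auto simp: field_simps)

lemma v_divide: "v (x / y) = v x / v y"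
  by (simp add: divide_inverse v_mult v_inverse)

lemma v_sum_le:
  assumes "\<And>i. i \<in> S \<Longrightarrow> v (f i) \<le> B" "0 \<le> B"
  shows "v (\<Sum>i\<in>S. f i) \<le> B"
  using assms(1)
proof (induction S rule: infinite_finite_induct)
  case (insert x F)
  have "v (f x + sum f F) \<le> max (v (f x)) (v (sum f F))" by (rule v_ultrametric)
  also have "\<dots> \<le> B" using insert by simp
  finally show ?case using insert by simp
qed (use assms(2) in auto)

lemma v_sum_less:
  assumes "\<And>i. i \<in> S \<Longrightarrow> v (f i) < B" "0 < B"
  shows "v (\<Sum>i\<in>S. f i) < B"
  using assms(1)
proof (induction S rule: infinite_finite_induct)
  case (insert x F)
  have "v (f x + sum f F) \<le> max (v (f x)) (v (sum f F))" by (rule v_ultrametric)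
  also have "\<dots> < B" using insert by simp
  finally show ?case using insert by simp
qed (use assms(2) in auto)

lemma v_of_nat_le: "v (of_nat n) \<le> 1"
proof (induction n)
  case (Suc n) then show ?case using v_ultrametric[of 1 "of_nat n"] by simp
qed simp

end

sublocale nonarch_field \<subseteq> nonarch_abs v
  by standard (rule v_nonneg v_eq_0_iff v_mult v_ultrametric)+

lemma subfield_closed:
  assumes "subfield K (Cring :: 'c::field ring)"
  shows "0 \<in> K" "1 \<in> K" "x \<in> K \<Longrightarrow> y \<in> K \<Longrightarrow> x + y \<in> K" "x \<in> K \<Longrightarrow> y \<in> K \<Longrightarrow> x * y \<in> K"
    "x \<in> K \<Longrightarrow> - x \<in> K" "x \<in> K \<Longrightarrow> y \<in> K \<Longrightarrow> x - y \<in> K" "x \<in> K \<Longrightarrow> inverse x \<in> K"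
    "x \<in> K \<Longrightarrow> y \<in> K \<Longrightarrow> x / y \<in> K" "x \<in> K \<Longrightarrow> x ^ n \<in> K" "of_nat n \<in> K"
proof -
  interpret R: field "Cring :: 'c ring" by rule
  have s: "subring K Cring" using assms subfieldE(1) by blast
  show 0: "0 \<in> K" and 1: "1 \<in> K" and m: "x \<in> K \<Longrightarrow> y \<in> K \<Longrightarrow> x * y \<in> K" for x y
    using subringE(2,3,6)[OF s] by auto
  show p: "x \<in> K \<Longrightarrow> y \<in> K \<Longrightarrow> x + y \<in> K" for x y using subringE(7)[OF s] by auto
  show n: "x \<in> K \<Longrightarrow> - x \<in> K" for x using subringE(5)[OF s] by (auto simp: Cring_a_inv)
  show "x \<in> K \<Longrightarrow> y \<in> K \<Longrightarrow> x - y \<in> K" using p[of x "- y"] n[of y] by simp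
  show i: "x \<in> K \<Longrightarrow> inverse x \<in> K" for x
    using R.subfield_m_inv(1)[OF assms, of x] 0 by (cases "x = 0") (auto simp: Cring_inv)
  show "x \<in> K \<Longrightarrow> y \<in> K \<Longrightarrow> x / y \<in> K" using m i by (simp add: divide_inverse)
  show "x \<in> K \<Longrightarrow> x ^ n \<in> K" by (induction n) (auto simp: 1 m)
  show "of_nat n \<in> K" by (induction n) (auto simp: 0 1 p)
qed

lemma coeffs_in_mono: "coeffs_in S f \<Longrightarrow> S \<subseteq> S' \<Longrightarrow> coeffs_in S' f"
  by (auto simp: coeffs_in_def)

lemma coeffs_in_closed:
  assumes "subfield K (Cring :: 'c::field ring)"
  shows "coeffs_in K f \<Longrightarrow> coeffs_in K g \<Longrightarrow> coeffs_in K (f + g)"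
    "coeffs_in K f \<Longrightarrow> coeffs_in K g \<Longrightarrow> coeffs_in K (f - g)"
    "a \<in> K \<Longrightarrow> coeffs_in K f \<Longrightarrow> coeffs_in K (Polynomial.smult a f)"
    "a \<in> K \<Longrightarrow> coeffs_in K f \<Longrightarrow> coeffs_in K (pCons a f)"
    "coeffs_in K 0"
    "a \<in> K \<Longrightarrow> coeffs_in K f \<Longrightarrow> poly f a \<in> K"
proof -
  note c = subfield_closed[OF assms]
  show "coeffs_in K f \<Longrightarrow> coeffs_in K g \<Longrightarrow> coeffs_in K (f + g)"
    "coeffs_in K f \<Longrightarrow> coeffs_in K g \<Longrightarrow> coeffs_in K (f - g)"
    "a \<in> K \<Longrightarrow> coeffs_in K f \<Longrightarrow> coeffs_in K (Polynomial.smult a f)"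
    "coeffs_in K 0"
    by (auto simp: coeffs_in_def c)
  show "a \<in> K \<Longrightarrow> coeffs_in K f \<Longrightarrow> coeffs_in K (pCons a f)"
    by (auto simp: coeffs_in_def coeff_pCons c split: nat.split)
  show "poly f a \<in> K" if "a \<in> K" "coeffs_in K f"
  proof -
    have "(\<Sum>i\<in>S. Polynomial.coeff f i * a ^ i) \<in> K" for S
      by (induction S rule: infinite_finite_induct) (use that in \<open>auto simp: coeffs_in_def c\<close>)
    then show ?thesis by (simp add: poly_altdef)
  qed
qed

lemma (in nonarch_field) K_subfield: "subfield K Cring" and Kbar_subfield: "subfield Kbar Cring"
  and K_subset_Kbar: "K \<subseteq> Kbar"
  using algebraic_closure_facts[OF algebraic_closure] by blast+

lemma (in nonarch_field) Kbar_root: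
  "coeffs_in Kbar f \<Longrightarrow> 0 < Polynomial.degree f \<Longrightarrow> \<exists>z\<in>Kbar. poly f z = 0"
  using algebraic_closure_facts[OF algebraic_closure] by blast

text \<open>The n-fold sum of 1 in the quotient ring is the coset of n, which is zero exactly when n
  lies in the maximal ideal. All later use of the residue characteristic goes through this
  equivalence.\<close>

lemma (in nonarch_field) v_of_nat_less_1_iff: "v (of_nat n) < 1 \<longleftrightarrow> residue_char v K dvd n"
proof -
  interpret R: field "Cring :: 'c ring" by rule
  note c = subfield_closed[OF K_subfield]
  let ?O = "{x \<in> K. v x \<le> 1}" and ?m = "{x \<in> K. v x < 1}"
  let ?S = "(Cring :: 'c ring)\<lparr>carrier := ?O\<rparr>"
  have add: "v (x + y) \<le> 1" if "v x \<le> 1" "v y \<le> 1" for x y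
    using v_ultrametric[of x y] that by simp
  have add': "v (x + y) < 1" if "v x < 1" "v y < 1" for x y
    using v_ultrametric[of x y] that by simp
  have sO: "subring ?O Cring"
    by (rule R.subringI) (auto simp: c Cring_a_inv v_mult mult_le_one add)
  interpret S: ring ?S by (rule R.subring_is_ring[OF sO])
  have ainv: "\<ominus>\<^bsub>?S\<^esub> x = - x" if "x \<in> ?O" for x
    by (rule S.minus_equality) (use that c in auto)
  have I: "ideal ?m ?S"
  proof (rule idealI[OF S.ring_axioms])
    show "subgroup ?m (add_monoid ?S)"
    proof (rule S.add.subgroupI)
      fix x assume "x \<in> ?m"
      then show "\<ominus>\<^bsub>?S\<^esub> x \<in> ?m" using ainv[of x] c by auto
    qed (auto simp: c add' intro: exI[of _ 0])
    show "x \<otimes>\<^bsub>?S\<^esub> a \<in> ?m" "a \<otimes>\<^bsub>?S\<^esub> x \<in> ?m" if "a \<in> ?m" "x \<in> carrier ?S" for a x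
    proof -
      have "v x * v a < 1"
        using that mult_left_le_one_le[of "v a" "v x"] by (auto simp: mult.commute)
      then show "x \<otimes>\<^bsub>?S\<^esub> a \<in> ?m" "a \<otimes>\<^bsub>?S\<^esub> x \<in> ?m" using that c by (auto simp: v_mult mult.commute)
    qed
  qed
  interpret I: ideal ?m ?S by (rule I)
  interpret Q: ring "?S Quot ?m" by (rule I.quotient_is_ring)
  have one: "\<one>\<^bsub>?S Quot ?m\<^esub> = ?m +>\<^bsub>?S\<^esub> 1" by (simp add: FactRing_def)
  have nO: "of_nat k \<in> ?O" for k using c v_of_nat_le by auto
  have pow: "\<one>\<^bsub>?S Quot ?m\<^esub> [^]\<^bsub>add_monoid (?S Quot ?m)\<^esub> k = ?m +>\<^bsub>?S\<^esub> of_nat k" for k :: nat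
  proof (induction k)
    case 0
    show ?case using I.a_rcos_const[of 0] c by (simp add: FactRing_def)
  next
    case (Suc k)
    then show ?case
      using I.a_rcos_sum[of "of_nat k" 1] nO[of k] nO[of 1] unfolding one
      by (simp add: FactRing_def add.commute)
  qed
  have "residue_char v K dvd n \<longleftrightarrow>
      \<one>\<^bsub>?S Quot ?m\<^esub> [^]\<^bsub>add_monoid (?S Quot ?m)\<^esub> n = \<one>\<^bsub>add_monoid (?S Quot ?m)\<^esub>"
    unfolding residue_char_def residue_field_def
    by (rule sym, rule group.pow_eq_id[OF Q.a_group]) simp
  also have "\<dots> \<longleftrightarrow> ?m +>\<^bsub>?S\<^esub> of_nat n = ?m"
    unfolding pow by (simp add: FactRing_def)
  also have "\<dots> \<longleftrightarrow> of_nat n \<in> ?m"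
    using I.rcos_const_imp_mem[of "of_nat n"] I.a_rcos_const[of "of_nat n"] nO[of n] by auto
  also have "\<dots> \<longleftrightarrow> v (of_nat n) < 1" using c by simp
  finally show ?thesis by simp
qed

text \<open>For prime p, \<open>d choose q\<close> has the same p-adic valuation as
  \<open>d div q\<close>, by \<open>const_p_fac\<close>, and q takes all of p out of d. For p = 0, q
  is 0^0 = 1 and the binomial coefficient is d.\<close>

lemma (in nonarch_field) v_choose_prime_power_multiplicity:
  assumes "0 < d"
  defines "q \<equiv> residue_char v K ^ multiplicity (residue_char v K) d"
  shows "q \<le> d" "1 \<le> q" "v (of_nat (d choose q)) = 1"
proof -
  define p where "p = residue_char v K"
  have dvd: "v (of_nat n) < 1 \<longleftrightarrow> p dvd n" for n unfolding p_def by (rule v_of_nat_less_1_iff)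
  have ne1: "p \<noteq> 1" using dvd[of 1] by auto
  \<comment> \<open>Primality is multiplicativity of \<open>v\<close>: if a and b have absolute
    value 1, so has a b.\<close>
  have prime: "Factorial_Ring.prime p" if "p \<noteq> 0"
  proof (rule prime_natI)
    show "2 \<le> p" using that ne1 by linarith
    fix a b assume "p dvd a * b"
    then have "v (of_nat a) * v (of_nat b) < 1" using dvd[of "a * b"] by (simp add: v_mult)
    moreover have "v (of_nat a) * v (of_nat b) = 1" if "v (of_nat a) = 1" "v (of_nat b) = 1"
      using that by simp
    ultimately have "v (of_nat a) < 1 \<or> v (of_nat b) < 1"
      using v_of_nat_le[of a] v_of_nat_le[of b] by (auto simp: order.order_iff_strict)
    then show "p dvd a \<or> p dvd b" using dvd by blast
  qed
  have q: "q = p ^ multiplicity p d" by (simp add: q_def p_def)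
  have qd: "q dvd d" using multiplicity_dvd[of p d] q by simp
  then show "q \<le> d" using assms(1) by (simp add: dvd_imp_le)
  show "1 \<le> q" using qd assms(1) by (cases "q = 0") auto
  have "\<not> p dvd (d choose q)"
  proof (cases "p = 0")
    case True
    then show ?thesis using assms(1) q by simp
  next
    case False
    then have p: "Factorial_Ring.prime p" using prime by simp
    obtain m where m: "d = q * m" using qd by blast
    have "\<not> p dvd d div q"
      using multiplicity_decompose[of d p] ne1 assms(1) unfolding q by auto
    then have "\<not> p dvd m" using m \<open>1 \<le> q\<close> by simp
    moreover have "m > 0" using m assms(1) by (cases m) auto
    ultimately have "multiplicity p (p ^ multiplicity p d * m choose p ^ multiplicity p d) = 0"
      using const_p_fac[of m p "multiplicity p d"] p by (simp add: not_dvd_imp_multiplicity_0)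
    then have "multiplicity p (d choose q) = 0"
      unfolding q[symmetric] m[symmetric] .
    then show ?thesis
      using p \<open>q \<le> d\<close> by (simp add: multiplicity_eq_zero_iff zero_less_binomial_iff prime_nat_iff)
  qed
  then show "v (of_nat (d choose q)) = 1"
    using dvd[of "d choose q"] v_of_nat_le[of "d choose q"] by linarith
qed

section \<open>Gauss norms\<close>

text \<open>The supremum seminorm of the disk of radius \<open>s\<close> about 0, read off from
  coefficients. Radii outside the value group are allowed, which later yields a path; at
  \<open>s = 0\<close> it is evaluation at 0, since 0^0 = 1.\<close>

definition gnorm :: "('c::field \<Rightarrow> real) \<Rightarrow> real \<Rightarrow> 'c poly \<Rightarrow> real" where
  "gnorm v s f = (MAX i\<in>{..Polynomial.degree f}. v (Polynomial.coeff f i) * s ^ i)"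

context nonarch_abs
begin

lemma gnorm_ge: "0 \<le> s \<Longrightarrow> v (Polynomial.coeff f i) * s ^ i \<le> gnorm v s f"
proof (cases "i \<le> Polynomial.degree f")
  case True
  then show ?thesis unfolding gnorm_def by (intro Max_ge) auto
next
  case False
  assume "0 \<le> s"
  have "0 \<le> v (Polynomial.coeff f 0) * s ^ 0" by simp
  also have "\<dots> \<le> gnorm v s f" unfolding gnorm_def by (intro Max_ge imageI) auto
  finally show ?thesis using False by (simp add: coeff_eq_0)
qed

lemma gnorm_attained: "\<exists>i\<le>Polynomial.degree f. gnorm v s f = v (Polynomial.coeff f i) * s ^ i"
proof -
  have "gnorm v s f \<in> (\<lambda>i. v (Polynomial.coeff f i) * s ^ i) ` {..Polynomial.degree f}"
    unfolding gnorm_def by (rule Max_in) auto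
  then show ?thesis by auto
qed

lemma gnorm_le: "(\<And>i. v (Polynomial.coeff f i) * s ^ i \<le> B) \<Longrightarrow> gnorm v s f \<le> B"
  using gnorm_attained[of f s] by auto

lemma gnorm_nonneg: "0 \<le> s \<Longrightarrow> 0 \<le> gnorm v s f"
  using gnorm_attained[of f s] by auto

lemma gnorm_eqI: "0 \<le> s \<Longrightarrow> (\<And>i. v (Polynomial.coeff f i) * s ^ i \<le> v (Polynomial.coeff f n) * s ^ n)
    \<Longrightarrow> gnorm v s f = v (Polynomial.coeff f n) * s ^ n"
  by (intro antisym gnorm_le gnorm_ge)

lemma gnorm_const [simp]: "gnorm v s [:c:] = v c"
  by (simp add: gnorm_def)

lemma gnorm_linear: "0 \<le> s \<Longrightarrow> gnorm v s [:b, c:] = max (v b) (v c * s)"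
  by (cases "c = 0") (auto simp: gnorm_def atMost_Suc max.commute max.absorb2 max.absorb1)

lemma gnorm_add: "0 \<le> s \<Longrightarrow> gnorm v s (f + g) \<le> max (gnorm v s f) (gnorm v s g)"
proof (rule gnorm_le)
  fix i assume s: "0 \<le> s"
  have "v (Polynomial.coeff (f + g) i) * s ^ i
      \<le> max (v (Polynomial.coeff f i)) (v (Polynomial.coeff g i)) * s ^ i"
    using v_ultrametric s by (simp add: mult_right_mono)
  also have "\<dots> = max (v (Polynomial.coeff f i) * s ^ i) (v (Polynomial.coeff g i) * s ^ i)"
    using s by (simp add: max_mult_distrib_right)
  also have "\<dots> \<le> max (gnorm v s f) (gnorm v s g)"
    using gnorm_ge[OF s, of f i] gnorm_ge[OF s, of g i] by linarith
  finally show "v (Polynomial.coeff (f + g) i) * s ^ i \<le> max (gnorm v s f) (gnorm v s g)" .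
qed

lemma gnorm_attained_first:
  assumes "0 \<le> s"
  obtains i where "gnorm v s f = v (Polynomial.coeff f i) * s ^ i"
    "\<And>j. j < i \<Longrightarrow> v (Polynomial.coeff f j) * s ^ j < gnorm v s f"
proof
  let ?P = "\<lambda>i. gnorm v s f = v (Polynomial.coeff f i) * s ^ i"
  show "?P (LEAST i. ?P i)" using gnorm_attained[of f s] LeastI_ex[of ?P] by blast
  show "v (Polynomial.coeff f j) * s ^ j < gnorm v s f" if "j < (LEAST i. ?P i)" for j
    using not_less_Least[OF that] gnorm_ge[OF assms, of f j] by linarith
qed

text \<open>Gauss's lemma: the coefficient of \<open>f * g\<close> at the sum of the first indices where the maxima
  for \<open>f\<close> and \<open>g\<close> are attained has a unique dominant term.\<close>

lemma gnorm_mult: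
  assumes s: "0 \<le> s"
  shows "gnorm v s (f * g) = gnorm v s f * gnorm v s g"
proof (rule antisym)
  have term_le: "v (Polynomial.coeff f i * Polynomial.coeff g j) * s ^ (i + j)
      \<le> gnorm v s f * gnorm v s g" for i j
  proof -
    have "v (Polynomial.coeff f i * Polynomial.coeff g j) * s ^ (i + j)
        = (v (Polynomial.coeff f i) * s ^ i) * (v (Polynomial.coeff g j) * s ^ j)"
      by (simp add: v_mult power_add mult_ac)
    also have "\<dots> \<le> gnorm v s f * gnorm v s g"
      using s gnorm_nonneg[OF s, of f] by (intro mult_mono gnorm_ge) auto
    finally show ?thesis .
  qed
  show "gnorm v s (f * g) \<le> gnorm v s f * gnorm v s g"
  proof (rule gnorm_le)
    fix n
    have "v (Polynomial.coeff (f * g) n) * s ^ n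
       = v (\<Sum>i\<le>n. Polynomial.coeff f i * Polynomial.coeff g (n - i)) * s ^ n"
      by (simp add: coeff_mult)
    also have "\<dots> \<le> gnorm v s f * gnorm v s g"
    proof (cases "s ^ n = 0")
      case False
      then have "s ^ n > 0" using zero_le_power[OF s, of n] by linarith
      moreover have "v (\<Sum>i\<le>n. Polynomial.coeff f i * Polynomial.coeff g (n - i))
          \<le> gnorm v s f * gnorm v s g / s ^ n"
      proof (rule v_sum_le)
        fix i assume "i \<in> {..n}"
        then show "v (Polynomial.coeff f i * Polynomial.coeff g (n - i))
            \<le> gnorm v s f * gnorm v s g / s ^ n"
          using term_le[of i "n - i"] \<open>s ^ n > 0\<close> by (simp add: pos_le_divide_eq)
      qed (use gnorm_nonneg[OF s] \<open>s ^ n > 0\<close> in simp)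
      ultimately show ?thesis by (simp add: field_simps)
    next
      case True
      show ?thesis
        unfolding True using gnorm_nonneg[OF s, of f] gnorm_nonneg[OF s, of g] by simp
    qed
    finally show "v (Polynomial.coeff (f * g) n) * s ^ n \<le> gnorm v s f * gnorm v s g" .
  qed
  show "gnorm v s f * gnorm v s g \<le> gnorm v s (f * g)"
  proof (cases "gnorm v s f * gnorm v s g = 0")
    case True
    show ?thesis unfolding True by (rule gnorm_nonneg[OF s])
  next
    case False
    then have "gnorm v s f \<noteq> 0" "gnorm v s g \<noteq> 0" by auto
    then have pos: "0 < gnorm v s f" "0 < gnorm v s g"
      using gnorm_nonneg[OF s, of f] gnorm_nonneg[OF s, of g] by linarith+
    obtain i0 where i0: "gnorm v s f = v (Polynomial.coeff f i0) * s ^ i0"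
      "\<And>j. j < i0 \<Longrightarrow> v (Polynomial.coeff f j) * s ^ j < gnorm v s f"
      using gnorm_attained_first[OF s, of f] by blast
    obtain j0 where j0: "gnorm v s g = v (Polynomial.coeff g j0) * s ^ j0"
      "\<And>j. j < j0 \<Longrightarrow> v (Polynomial.coeff g j) * s ^ j < gnorm v s g"
      using gnorm_attained_first[OF s, of g] by blast
    define n where "n = i0 + j0"
    have "s ^ i0 \<noteq> 0" "s ^ j0 \<noteq> 0" using pos i0(1) j0(1) by (metis mult_zero_right less_irrefl)+
    then have sn: "0 < s ^ n"
      using zero_le_power[OF s, of i0] zero_le_power[OF s, of j0]
      unfolding n_def power_add by (intro mult_pos_pos) linarith+
    let ?t = "\<lambda>i. Polynomial.coeff f i * Polynomial.coeff g (n - i)"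
    have main: "v (?t i0) * s ^ n = gnorm v s f * gnorm v s g"
      using i0(1) j0(1) by (simp add: n_def v_mult power_add mult_ac)
    have "v (?t i) < v (?t i0)" if "i \<in> {..n} - {i0}" for i
    proof -
      have eq: "v (?t i) * s ^ n = (v (Polynomial.coeff f i) * s ^ i) *
          (v (Polynomial.coeff g (n - i)) * s ^ (n - i))"
        using that by (simp add: v_mult mult_ac flip: power_add)
      have "\<dots> < gnorm v s f * gnorm v s g"
      proof (cases "i < i0")
        case True
        have "(v (Polynomial.coeff f i) * s ^ i) * (v (Polynomial.coeff g (n - i)) * s ^ (n - i))
            \<le> (v (Polynomial.coeff f i) * s ^ i) * gnorm v s g"
          using s by (intro mult_left_mono gnorm_ge) auto
        also have "\<dots> < gnorm v s f * gnorm v s g"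
          using i0(2)[OF True] pos by (intro mult_strict_right_mono) auto
        finally show ?thesis .
      next
        case False
        then have "n - i < j0" using that by (auto simp: n_def)
        have "(v (Polynomial.coeff f i) * s ^ i) * (v (Polynomial.coeff g (n - i)) * s ^ (n - i))
            \<le> gnorm v s f * (v (Polynomial.coeff g (n - i)) * s ^ (n - i))"
          using s by (intro mult_right_mono gnorm_ge) auto
        also have "\<dots> < gnorm v s f * gnorm v s g"
          using j0(2)[OF \<open>n - i < j0\<close>] pos by (intro mult_strict_left_mono) auto
        finally show ?thesis .
      qed
      then have "v (?t i) * s ^ n < v (?t i0) * s ^ n" unfolding eq main .
      then show ?thesis using sn by (intro mult_right_less_imp_less[of "v (?t i)" "s ^ n"]) auto
    qed
    moreover have "0 < v (?t i0)" using v_nonneg[of "?t i0"] mult_pos_pos[OF pos] main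
      by (metis less_eq_real_def mult_zero_left less_irrefl)
    ultimately have "v (\<Sum>i\<in>{..n} - {i0}. ?t i) < v (?t i0)"
      by (intro v_sum_less) auto
    then have "v ((\<Sum>i\<in>{..n} - {i0}. ?t i) + ?t i0) = v (?t i0)" by (rule v_add_eq)
    moreover have "(\<Sum>i\<in>{..n} - {i0}. ?t i) + ?t i0 = Polynomial.coeff (f * g) n"
      using sum.remove[of "{..n}" i0 ?t] by (simp add: coeff_mult n_def add.commute)
    ultimately show ?thesis using main gnorm_ge[OF s, of "f * g" n] by simp
  qed
qed

lemma continuous_on_gnorm: "continuous_on UNIV (\<lambda>s. gnorm v s f)"
proof -
  have "continuous_on UNIV (\<lambda>s. MAX i\<in>S. v (Polynomial.coeff f i) * s ^ i)"
    if "finite S" "S \<noteq> {}" for S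
    using that
  proof (induction S rule: finite_ne_induct)
    case (insert x F)
    then show ?case by (auto intro!: continuous_intros continuous_on_max)
  qed (auto intro!: continuous_intros)
  then show ?thesis unfolding gnorm_def by simp
qed

section \<open>Points of the Berkovich affine line: Gauss norm bounds and dominant terms\<close>

lemma A1_BerkD:
  assumes "x \<in> A1_Berk v"
  shows A1_const: "x [:c:] = v c" and A1_mult: "x (f * g) = x f * x g"
    and A1_add: "x (f + g) \<le> max (x f) (x g)"
  using assms unfolding A1_Berk_def by auto

lemma A1_smult: "x \<in> A1_Berk v \<Longrightarrow> x (Polynomial.smult c f) = v c * x f"
  using A1_mult[of x "[:c:]" f] by (simp add: A1_const)

lemma A1_minus: "x \<in> A1_Berk v \<Longrightarrow> x (- f) = x f"
  using A1_smult[of x "-1" f] by simp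

lemma A1_diff: "x \<in> A1_Berk v \<Longrightarrow> x (f - g) \<le> max (x f) (x g)"
  using A1_add[of x f "- g"] by (simp add: A1_minus)

lemma A1_0: "x \<in> A1_Berk v \<Longrightarrow> x 0 = 0"
  using A1_const[of x 0] by simp

lemma A1_1: "x \<in> A1_Berk v \<Longrightarrow> x 1 = 1"
  using A1_const[of x 1] by (simp add: pCons_one)

lemma A1_nonneg: "x \<in> A1_Berk v \<Longrightarrow> 0 \<le> x f"
  using A1_diff[of x f f] by (simp add: A1_0)

lemma A1_power: "x \<in> A1_Berk v \<Longrightarrow> x (f ^ n) = x f ^ n"
  by (induction n) (simp_all add: A1_1 A1_mult)

lemma A1_add_eq: "x \<in> A1_Berk v \<Longrightarrow> x f < x g \<Longrightarrow> x (f + g) = x g"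
  using A1_add[of x f g] A1_diff[of x "f + g" f] by (auto simp: max_def split: if_splits)

lemma A1_sum_le:
  assumes "x \<in> A1_Berk v" "\<And>i. i \<in> S \<Longrightarrow> x (f i) \<le> B" "0 \<le> B"
  shows "x (\<Sum>i\<in>S. f i) \<le> B"
  using assms(2)
proof (induction S rule: infinite_finite_induct)
  case (insert y F)
  have "x (f y + sum f F) \<le> max (x (f y)) (x (sum f F))" by (rule A1_add[OF assms(1)])
  also have "\<dots> \<le> B" using insert by simp
  finally show ?case using insert by simp
qed (use assms in \<open>auto simp: A1_0\<close>)

lemma A1_monom: "x \<in> A1_Berk v \<Longrightarrow> x (Polynomial.monom c n) = v c * x [:0, 1:] ^ n"
  by (simp add: monom_altdef A1_smult A1_power)

text \<open>By expansion into monomials, the Gauss norm is the largest seminorm with |T| at most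
  \<open>s\<close>. This covers evaluation at points and also gives the bounds for compactness and
  approximation below.\<close>

lemma A1_le_gnorm:
  assumes "x \<in> A1_Berk v" "x [:0, 1:] \<le> s"
  shows "x f \<le> gnorm v s f"
proof -
  have s: "0 \<le> s" using A1_nonneg[OF assms(1), of "[:0,1:]"] assms(2) by linarith
  have "x (\<Sum>i\<le>Polynomial.degree f. Polynomial.monom (Polynomial.coeff f i) i) \<le> gnorm v s f"
  proof (rule A1_sum_le[OF assms(1)])
    fix i
    have "v (Polynomial.coeff f i) * x [:0, 1:] ^ i \<le> v (Polynomial.coeff f i) * s ^ i"
      using assms A1_nonneg by (intro mult_left_mono power_mono) auto
    then show "x (Polynomial.monom (Polynomial.coeff f i) i) \<le> gnorm v s f"
      using gnorm_ge[OF s, of f i] by (simp add: A1_monom[OF assms(1)])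
  qed (rule gnorm_nonneg[OF s])
  then show ?thesis by (simp add: poly_as_sum_of_monoms)
qed

text \<open>Outside the closed unit disk the top monomial strictly beats the others, as its
  coefficient is maximal and |T| > 1. If the degree is below \<open>n\<close>, maximality forces
  \<open>f = 0\<close>.\<close>

lemma A1_dominant:
  assumes x: "x \<in> A1_Berk v" "1 < x [:0, 1:]"
    and deg: "Polynomial.degree f \<le> n"
    and dom: "\<And>i. v (Polynomial.coeff f i) \<le> v (Polynomial.coeff f n)"
  shows "x f = v (Polynomial.coeff f n) * x [:0, 1:] ^ n"
proof (cases "Polynomial.coeff f n = 0")
  case True
  then have "v (Polynomial.coeff f i) = 0" for i
    using dom[of i] v_nonneg[of "Polynomial.coeff f i"] unfolding True v_0 by linarith
  then have "f = 0" by (intro poly_eqI) simp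
  then show ?thesis by (simp add: A1_0[OF x(1)])
next
  case False
  let ?R = "x [:0, 1:]"
  let ?m = "\<lambda>i. Polynomial.monom (Polynomial.coeff f i) i"
  have n: "f = (\<Sum>i<n. ?m i) + ?m n"
    using poly_as_sum_of_monoms'[OF deg] by (simp add: lessThan_Suc_atMost[symmetric])
  have "x (\<Sum>i<n. ?m i) < x (?m n)"
  proof (cases n)
    case 0
    then show ?thesis using False by (simp add: A1_monom[OF x(1)] A1_0[OF x(1)] v_pos)
  next
    case (Suc k)
    have "x (\<Sum>i<n. ?m i) \<le> v (Polynomial.coeff f n) * ?R ^ k"
    proof (rule A1_sum_le[OF x(1)])
      fix i assume "i \<in> {..<n}"
      then show "x (?m i) \<le> v (Polynomial.coeff f n) * ?R ^ k"
        using x(2) dom[of i] Suc by (auto simp: A1_monom[OF x(1)] intro!: mult_mono power_increasing)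
    qed (use x in auto)
    also have "\<dots> < v (Polynomial.coeff f n) * ?R ^ n"
      using False x(2) Suc v_pos[of "Polynomial.coeff f n"] by simp
    finally show ?thesis by (simp add: A1_monom[OF x(1)])
  qed
  from A1_add_eq[OF x(1) this] show ?thesis unfolding n[symmetric] by (simp add: A1_monom[OF x(1)])
qed

lemma eval_in_A1: "(\<lambda>f. v (poly f z)) \<in> A1_Berk v"
  unfolding A1_Berk_def by (auto simp: v_mult v_ultrametric)

lemma A1_pcompose:
  assumes "x \<in> A1_Berk v"
  shows "(\<lambda>f. x (pcompose f g)) \<in> A1_Berk v"
  using assms unfolding A1_Berk_def by (auto simp: pcompose_mult pcompose_add)

lemma gnorm_in_A1: "0 \<le> s \<Longrightarrow> gnorm v s \<in> A1_Berk v"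
  unfolding A1_Berk_def by (auto simp: gnorm_mult gnorm_add)

lemma v_poly_le: "v z \<le> 1 \<Longrightarrow> v (poly f z) \<le> gnorm v 1 f"
  using A1_le_gnorm[OF eval_in_A1, of z 1 f] by simp

lemma v_poly_dominant:
  assumes "1 < v z" "Polynomial.degree f \<le> n"
    "\<And>i. v (Polynomial.coeff f i) \<le> v (Polynomial.coeff f n)"
  shows "v (poly f z) = v (Polynomial.coeff f n) * v z ^ n"
  using A1_dominant[OF eval_in_A1, of z f n] assms by simp

end

section \<open>Supremum seminorms of disks as Gauss norms\<close>

context nonarch_field
begin

lemma Kbar_approx: 
  assumes "0 < \<epsilon>" obtains k where "k \<in> Kbar" "v (z - k) < \<epsilon>"
proof -
  interpret M: Metric_space UNIV "\<lambda>x y. v (x - y)"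
  proof
    show "v (x - z) \<le> v (x - y) + v (y - z)" for x y z
    proof -
      have "v (x - z) \<le> max (v (x - y)) (v (y - z))" using v_ultrametric[of "x - y" "y - z"] by simp
      also have "\<dots> \<le> v (x - y) + v (y - z)" by simp
      finally show ?thesis .
    qed
  qed (auto simp: v_minus_commute)
  have "z \<in> M.mtopology closure_of Kbar" using Kbar_dense by simp
  then show ?thesis using assms that by (auto simp: M.metric_closure_of)
qed

text \<open>The residue field is infinite, being algebraically closed; so the maximum of a polynomial on
  the closed unit disk is attained where the reduction does not vanish. Here such a point is a
  root of an approximation to \<open>g - 1\<close>.\<close>

lemma gnorm_1_attained: "\<exists>w. v w \<le> 1 \<and> v (poly g w) = gnorm v 1 g"
proof (cases "g = 0")
  case True
  then show ?thesis by (auto simp: gnorm_def intro!: exI[of _ 0])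
next
  case False
  obtain i where i: "gnorm v 1 g = v (Polynomial.coeff g i)"
    using gnorm_attained[of g 1] by auto
  have le: "v (Polynomial.coeff g j) \<le> v (Polynomial.coeff g i)" for j
    using gnorm_ge[of 1 g j] i by simp
  have gi: "Polynomial.coeff g i \<noteq> 0"
  proof
    assume "Polynomial.coeff g i = 0"
    then have "v (Polynomial.coeff g j) = 0" for j
      using le[of j] v_nonneg[of "Polynomial.coeff g j"] unfolding v_0 by simp
    then have "g = 0" by (intro poly_eqI) simp
    with False show False by simp
  qed
  define h where "h = Polynomial.smult (inverse (Polynomial.coeff g i)) g"
  have h: "v (Polynomial.coeff h j) = v (Polynomial.coeff g j) / v (Polynomial.coeff g i)" for j
    by (simp add: h_def v_mult v_inverse divide_inverse mult.commute)
  have hle: "v (Polynomial.coeff h j) \<le> 1" for j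
    using h le gi by (simp add: v_pos)
  have hi: "v (Polynomial.coeff h i) = 1" using h gi by simp
  define S where "S = {j. v (Polynomial.coeff h j) = 1}"
  have S: "S \<subseteq> {..Polynomial.degree h}" using coeff_eq_0[of h] by (force simp: S_def not_less[symmetric])
  then have fin: "finite S" by (rule finite_subset) simp
  have iS: "i \<in> S" using hi by (simp add: S_def)
  define N where "N = Max S"
  have NS: "N \<in> S" unfolding N_def using fin iS by (intro Max_in) auto
  have Nge: "j \<le> N" if "j \<in> S" for j unfolding N_def using fin that by simp
  have "\<forall>j. \<exists>k. k \<in> Kbar \<and> v (Polynomial.coeff h j - k) < 1"
    using Kbar_approx[of 1] by (metis zero_less_one)
  then obtain k where k: "\<And>j. k j \<in> Kbar" "\<And>j. v (Polynomial.coeff h j - k j) < 1" by metis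
  have vk: "v (k j) = 1" if "j \<in> S" for j
    using v_diff_eq[of "Polynomial.coeff h j - k j" "Polynomial.coeff h j"] k(2)[of j] that
    by (simp add: S_def)
  have "\<exists>w. v w \<le> 1 \<and> v (poly h w) = 1"
  \<comment> \<open>If \<open>N = 0\<close>, the reduction of \<open>h\<close> is a nonzero constant
    and \<open>w = 0\<close> works; the root argument needs a nonconstant reduction.\<close>
  proof (cases "N = 0")
    case True
    then show ?thesis using NS by (auto simp: S_def poly_0_coeff_0 intro!: exI[of _ 0])
  next
    case False
    \<comment> \<open>\<open>t\<close> lifts the reduction of \<open>h\<close> to coefficients in
      \<open>Kbar\<close>, keeping only the unit coefficients, so that all coefficients of
      \<open>h - t\<close> are smaller than 1. Where \<open>t\<close> equals 1, \<open>h\<close> has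
      absolute value 1.\<close>
    define t where "t = (\<Sum>j\<in>S. Polynomial.monom (k j) j)"
    have ct: "Polynomial.coeff t j = (if j \<in> S then k j else 0)" for j
      unfolding t_def using fin by (simp add: coeff_sum if_distrib cong: if_cong)
    have ct1: "Polynomial.coeff (t - 1) j = (if j \<in> S then k j else 0) - (if j = 0 then 1 else 0)" for j
      by (simp add: ct)
    have deg: "Polynomial.degree (t - 1) \<le> N"
      by (rule degree_le) (auto simp: ct dest!: Nge)
    have lead: "Polynomial.coeff (t - 1) N = k N" using NS False by (simp add: ct)
    have "Polynomial.coeff (t - 1) N \<noteq> 0" using vk[OF NS] lead by auto
    then have "0 < Polynomial.degree (t - 1)" using False le_degree by fastforce
    moreover have "coeffs_in Kbar (t - 1)"
      using k(1) subfield_closed[OF Kbar_subfield] by (simp add: coeffs_in_def ct)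
    ultimately obtain w where w: "w \<in> Kbar" "poly (t - 1) w = 0" using Kbar_root by blast
    have "v w \<le> 1"
    proof (rule ccontr)
      assume "\<not> v w \<le> 1"
      then have "v (poly (t - 1) w) = v (Polynomial.coeff (t - 1) N) * v w ^ N"
      proof (intro v_poly_dominant deg)
        fix j
        have "v (k j - 1) \<le> 1" if "j \<in> S" using v_diff_le[of "k j" 1] vk[OF that] by simp
        then show "v (Polynomial.coeff (t - 1) j) \<le> v (Polynomial.coeff (t - 1) N)"
          unfolding lead vk[OF NS] using vk by (auto simp: ct)
      qed simp
      then show False using w \<open>\<not> v w \<le> 1\<close> lead vk[OF NS] by simp
    qed
    have "gnorm v 1 (h - t) < 1"
    proof -
      obtain j where j: "gnorm v 1 (h - t) = v (Polynomial.coeff (h - t) j)"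
        using gnorm_attained[of "h - t" 1] by auto
      have "v (Polynomial.coeff (h - t) j) < 1"
        using k(2)[of j] hle[of j] by (auto simp: ct S_def)
      then show ?thesis using j by simp
    qed
    then have "v (poly (h - t) w) < v 1"
      using v_poly_le[OF \<open>v w \<le> 1\<close>, of "h - t"] by simp
    from v_add_eq[OF this] have "v (poly h w) = 1" using w(2) by simp
    then show ?thesis using \<open>v w \<le> 1\<close> by blast
  qed
  then obtain w where w: "v w \<le> 1" "v (poly h w) = 1" by blast
  have "v (poly h w) = v (poly g w) / v (Polynomial.coeff g i)"
    by (simp add: h_def v_mult v_inverse divide_inverse mult.commute)
  then have "v (poly g w) = gnorm v 1 g" using w(2) i gi by (simp add: field_simps)
  then show ?thesis using w(1) by blast
qed

text \<open>Substituting z = a + c w turns the disk into the unit disk. There the Gauss norm is an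
  upper bound, and \<open>gnorm_1_attained\<close> makes it a maximum. From here on type II points
  are handled through coefficients.\<close>

lemma zeta_eq_gnorm:
  assumes "c \<noteq> 0"
  shows "zeta v a (v c) f = gnorm v 1 (pcompose f [:a, c:])"
  unfolding zeta_def
proof (rule cSup_eq_maximum)
  obtain w where w: "v w \<le> 1" "v (poly (pcompose f [:a, c:]) w) = gnorm v 1 (pcompose f [:a, c:])"
    using gnorm_1_attained by blast
  have "v (a + c * w - a) \<le> v c" using w(1) by (simp add: v_mult mult_left_le)
  moreover have "gnorm v 1 (pcompose f [:a, c:]) = v (poly f (a + c * w))"
    using w(2) by (simp add: poly_pcompose mult.commute)
  ultimately show "gnorm v 1 (pcompose f [:a, c:]) \<in> (\<lambda>z. v (poly f z)) ` {z. v (z - a) \<le> v c}"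
    by blast
  fix y assume "y \<in> (\<lambda>z. v (poly f z)) ` {z. v (z - a) \<le> v c}"
  then obtain z where z: "y = v (poly f z)" "v (z - a) \<le> v c" by blast
  have "v ((z - a) / c) \<le> 1" using z(2) assms by (simp add: v_divide v_pos)
  from v_poly_le[OF this, of "pcompose f [:a, c:]"] show "y \<le> gnorm v 1 (pcompose f [:a, c:])"
    using z(1) assms by (simp add: poly_pcompose)
qed

text \<open>Every point of an ultrametric disk is a center; this serves to move the center into
  \<open>Kbar\<close>.\<close>

lemma zeta_recenter:
  assumes "v (a - b) \<le> r"
  shows "zeta v a r = zeta v b r"
proof -
  have "v (z - a) \<le> r \<longleftrightarrow> v (z - b) \<le> r" for z
    using v_ultrametric[of "z - a" "a - b"] v_diff_le[of "z - b" "a - b"] assms by auto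
  then show ?thesis by (simp add: zeta_def)
qed

end

section \<open>The Berkovich line\<close>

lemma coeffs_in_synthetic_div:
  assumes "subfield K (Cring :: 'c::field ring)" "c \<in> K"
  shows "coeffs_in K f \<Longrightarrow> coeffs_in K (synthetic_div f c)"
proof (induction f)
  case (pCons a f)
  have "coeffs_in K f"
    unfolding coeffs_in_def
  proof
    show "Polynomial.coeff f i \<in> K" for i
      using pCons.prems unfolding coeffs_in_def by (metis coeff_pCons_Suc)
  qed
  then show ?case using pCons.IH coeffs_in_closed[OF assms(1)] assms(2) by simp
qed (simp add: coeffs_in_closed[OF assms(1)])

context nonarch_field
begin

text \<open>Polynomials over \<open>Kbar\<close> split into linear factors, and seminorms are
  multiplicative. Splitting is known over \<open>Kbar\<close> only; \<open>A1_eqI\<close> removes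
  the restriction by density.\<close>

lemma A1_eqI_Kbar:
  assumes x: "x \<in> A1_Berk v" and y: "y \<in> A1_Berk v"
    and lin: "\<And>c. c \<in> Kbar \<Longrightarrow> x [:-c, 1:] = y [:-c, 1:]"
  shows "coeffs_in Kbar f \<Longrightarrow> x f = y f"
proof (induction "Polynomial.degree f" arbitrary: f)
  case 0
  then obtain c where "f = [:c:]" by (metis degree_eq_zeroE)
  then show ?case using x y by (simp add: A1_const)
next
  case (Suc n)
  then obtain c where c: "c \<in> Kbar" "poly f c = 0" using Kbar_root by (metis zero_less_Suc)
  let ?g = "synthetic_div f c"
  have f: "f = [:-c, 1:] * ?g" using synthetic_div_correct'[of c f] c(2) by simp
  have "x ?g = y ?g"
    by (rule Suc(1)) (use Suc c coeffs_in_synthetic_div[OF Kbar_subfield] in \<open>auto simp: degree_synthetic_div\<close>)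
  moreover have "x f = x [:-c, 1:] * x ?g" by (subst f) (rule A1_mult[OF x])
  moreover have "y f = y [:-c, 1:] * y ?g" by (subst f) (rule A1_mult[OF y])
  ultimately show ?case using lin[OF c(1)] by simp
qed

lemma Kbar_poly_approx:
  assumes "0 < \<epsilon>" "0 \<le> s" obtains h where "coeffs_in Kbar h" "gnorm v s (f - h) \<le> \<epsilon>"
proof -
  define n where "n = Polynomial.degree f"
  \<comment> \<open>The base \<open>s + 1\<close> instead of \<open>s\<close> avoids division by
    zero when \<open>s = 0\<close>.\<close>
  have "\<forall>i. \<exists>k. k \<in> Kbar \<and> v (Polynomial.coeff f i - k) < \<epsilon> / (s + 1) ^ i"
    using Kbar_approx assms by (metis add_nonneg_pos divide_pos_pos zero_less_one zero_less_power)
  then obtain k where k: "\<And>i. k i \<in> Kbar"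
    "\<And>i. v (Polynomial.coeff f i - k i) < \<epsilon> / (s + 1) ^ i" by metis
  define h where "h = (\<Sum>i\<le>n. Polynomial.monom (k i) i)"
  have ch: "Polynomial.coeff h i = (if i \<le> n then k i else 0)" for i
    unfolding h_def by (simp add: coeff_sum if_distrib cong: if_cong)
  have "gnorm v s (f - h) \<le> \<epsilon>"
  proof (rule gnorm_le)
    fix i
    show "v (Polynomial.coeff (f - h) i) * s ^ i \<le> \<epsilon>"
    proof (cases "i \<le> n")
      case True
      have "v (Polynomial.coeff f i - k i) * s ^ i \<le> \<epsilon> / (s + 1) ^ i * (s + 1) ^ i"
        using k(2)[of i] assms by (intro mult_mono power_mono) auto
      then show ?thesis using True assms by (simp add: ch)
    qed (use assms in \<open>simp add: ch n_def coeff_eq_0\<close>)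
  qed
  moreover have "coeffs_in Kbar h"
    using k(1) subfield_closed[OF Kbar_subfield] by (simp add: coeffs_in_def ch)
  ultimately show ?thesis using that by blast
qed

text \<open>Both seminorms are bounded by the Gauss norm of one common radius, so replacing
  \<open>f\<close> by a close polynomial over \<open>Kbar\<close> introduces an error of at most
  \<epsilon> in each.\<close>

lemma A1_eqI:
  assumes x: "x \<in> A1_Berk v" and y: "y \<in> A1_Berk v"
    and lin: "\<And>c. c \<in> Kbar \<Longrightarrow> x [:-c, 1:] = y [:-c, 1:]"
  shows "x = y"
proof
  fix f
  define s where "s = max (x [:0, 1:]) (y [:0, 1:])"
  have s: "0 \<le> s" "x [:0, 1:] \<le> s" "y [:0, 1:] \<le> s"
    using A1_nonneg[OF x, of "[:0, 1:]"] by (auto simp: s_def)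
  have le: "z f \<le> max (w f) \<epsilon>"
    if z: "z \<in> A1_Berk v" "z [:0, 1:] \<le> s" and w: "w \<in> A1_Berk v" "w [:0, 1:] \<le> s"
      and eq: "\<And>c. c \<in> Kbar \<Longrightarrow> z [:-c, 1:] = w [:-c, 1:]" and "0 < \<epsilon>" for z w \<epsilon>
  proof -
    obtain h where h: "coeffs_in Kbar h" "gnorm v s (f - h) \<le> \<epsilon>"
      using Kbar_poly_approx[OF \<open>0 < \<epsilon>\<close> s(1)] by blast
    have "z f \<le> max (z (f - h)) (z h)" using A1_add[OF z(1), of "f - h" h] by simp
    moreover have "z h = w h" by (rule A1_eqI_Kbar[OF z(1) w(1) eq h(1)])
    moreover have "w h \<le> max (w f) (w (f - h))" using A1_diff[OF w(1), of f "f - h"] by simp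
    ultimately show ?thesis
      using A1_le_gnorm[OF z, of "f - h"] A1_le_gnorm[OF w, of "f - h"] h(2) by linarith
  qed
  have le': "z f \<le> w f"
    if "z \<in> A1_Berk v" "z [:0, 1:] \<le> s" "w \<in> A1_Berk v" "w [:0, 1:] \<le> s"
      "\<And>c. c \<in> Kbar \<Longrightarrow> z [:-c, 1:] = w [:-c, 1:]" for z w
  proof (rule field_le_epsilon)
    fix \<epsilon> :: real assume "0 < \<epsilon>"
    then show "z f \<le> w f + \<epsilon>"
      using le[OF that \<open>0 < \<epsilon>\<close>] A1_nonneg[OF that(3), of f] by (simp add: max_def split: if_splits)
  qed
  show "x f = y f"
    using le'[OF x s(2) y s(3) lin] le'[OF y s(3) x s(2) lin[symmetric]] by simp
qed

section \<open>Topology of the Berkovich line and the component of infinity at a type II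
  point\<close>

lemma closed_A1: "closed (A1_Berk v)"
proof -
  have c [continuous_intros]: "continuous_on UNIV (\<lambda>x :: 'c poly \<Rightarrow> real. x f)" for f
    by (rule continuous_on_product_coordinates)
  have "A1_Berk v = {x. \<forall>c. x [:c:] = v c} \<inter> {x. \<forall>f g. x (f * g) = x f * x g} \<inter>
      {x. \<forall>f g. x (f + g) \<le> max (x f) (x g)}"
    unfolding A1_Berk_def by auto
  also have "closed \<dots>"
    by (intro closed_Int closed_Collect_all closed_Collect_eq closed_Collect_le continuous_intros
        continuous_on_max)
  finally show ?thesis .
qed

lemma closed_A1_disk: "closed {x \<in> A1_Berk v. x [:-a, 1:] \<le> r}"
proof -
  have "{x \<in> A1_Berk v. x [:-a, 1:] \<le> r} = A1_Berk v \<inter> {x. x [:-a, 1:] \<le> r}" by auto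
  also have "closed \<dots>"
    by (intro closed_Int closed_A1 closed_Collect_le continuous_on_product_coordinates
        continuous_intros)
  finally show ?thesis .
qed

text \<open>A bound on |z - a| bounds every value by a Gauss norm, so the set is a closed subset of
  a product of compact intervals (Tychonoff).\<close>

lemma compact_A1_disk: "compact {x \<in> A1_Berk v. x [:-a, 1:] \<le> r}"
proof -
  let ?C = "{x \<in> A1_Berk v. x [:-a, 1:] \<le> r}"
  define s where "s = max \<bar>r\<bar> (v a)"
  have sub: "?C \<subseteq> (\<Pi>\<^sub>E f\<in>UNIV. {0..gnorm v s f})"
  proof
    fix x assume "x \<in> ?C"
    then have x: "x \<in> A1_Berk v" "x [:-a, 1:] \<le> r" by auto
    have "x [:0, 1:] \<le> max (x [:-a, 1:]) (x [:a:])"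
      using A1_add[OF x(1), of "[:-a, 1:]" "[:a:]"] by simp
    also have "\<dots> \<le> s" using x(2) by (auto simp: s_def A1_const[OF x(1)])
    finally have "x f \<le> gnorm v s f" for f by (rule A1_le_gnorm[OF x(1)])
    then show "x \<in> (\<Pi>\<^sub>E f\<in>UNIV. {0..gnorm v s f})" using A1_nonneg[OF x(1)] by (auto simp: PiE_UNIV_domain)
  qed
  have "compactin (powertop_real UNIV) (\<Pi>\<^sub>E f\<in>UNIV. {0..gnorm v s f})"
    by (simp add: compactin_PiE)
  then have "compact (\<Pi>\<^sub>E f\<in>UNIV. {0..gnorm v s f})"
    by (simp add: euclidean_product_topology)
  then have "compact ((\<Pi>\<^sub>E f\<in>UNIV. {0..gnorm v s f}) \<inter> ?C)"
    by (rule compact_Int_closed) (rule closed_A1_disk)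
  then show ?thesis using sub by (simp add: Int_absorb1)
qed

text \<open>The direction of infinity at the point of the disk, cut out by a single inequality on z
  - a. Its complement is the compact set above, which makes it an open neighborhood of
  infinity.\<close>

definition outer :: "'c \<Rightarrow> real \<Rightarrow> ('c poly \<Rightarrow> real) option set" where
  "outer a r = insert None (Some ` {x \<in> A1_Berk v. r < x [:-a, 1:]})"

definition disk :: "'c \<Rightarrow> real \<Rightarrow> ('c poly \<Rightarrow> real) option set" where
  "disk a r = Some ` {x \<in> A1_Berk v. x [:-a, 1:] < r}"

lemma P1_Berk_alt: "P1_Berk v = Alexandroff_compactification (top_of_set (A1_Berk v))"
  by (simp add: P1_Berk_def euclidean_product_topology)

lemma topspace_P1: "topspace (P1_Berk v) = insert None (Some ` A1_Berk v)"
  by (simp add: P1_Berk_alt)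

lemma openin_outer: "openin (P1_Berk v) (outer a r)"
proof -
  let ?C = "{x \<in> A1_Berk v. x [:-a, 1:] \<le> r}"
  have "compactin (top_of_set (A1_Berk v)) ?C"
    using compact_A1_disk[of a r] by (auto simp: compactin_subtopology)
  moreover have "closedin (top_of_set (A1_Berk v)) ?C"
    using closed_A1_disk[of a r] by (intro closed_subset) auto
  moreover have "outer a r = insert None (Some ` (topspace (top_of_set (A1_Berk v)) - ?C))"
    by (auto simp: outer_def)
  ultimately show ?thesis unfolding P1_Berk_alt openin_Alexandroff_compactification by blast
qed

lemma openin_disk: "openin (P1_Berk v) (disk a r)"
proof -
  have "open {x :: 'c poly \<Rightarrow> real. x [:-a, 1:] < r}"
    by (intro open_Collect_less continuous_on_product_coordinates continuous_intros)
  then have "openin (top_of_set (A1_Berk v)) (A1_Berk v \<inter> {x. x [:-a, 1:] < r})"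
    by (rule openin_open_Int)
  moreover have "A1_Berk v \<inter> {x. x [:-a, 1:] < r} = {x \<in> A1_Berk v. x [:-a, 1:] < r}" by auto
  ultimately show ?thesis unfolding P1_Berk_alt disk_def by simp
qed

lemma zeta_in_A1: "c \<noteq> 0 \<Longrightarrow> zeta v a (v c) \<in> A1_Berk v"
proof -
  assume "c \<noteq> 0"
  then have "zeta v a (v c) = (\<lambda>f. gnorm v 1 (pcompose f [:a, c:]))" by (intro ext zeta_eq_gnorm)
  then show ?thesis using A1_pcompose[OF gnorm_in_A1[of 1], of "[:a, c:]"] by simp
qed

lemma zeta_linear: "c \<noteq> 0 \<Longrightarrow> zeta v a (v c) [:-b, 1:] = max (v (a - b)) (v c)"
  by (simp add: zeta_eq_gnorm pcompose_pCons gnorm_linear)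

text \<open>A point of the closed disk that lies in no residue disk has the same value as \<open>\<zeta>(a,r)\<close> on
  every linear polynomial.\<close>

lemma complement_zeta_cases:
  assumes c: "c \<noteq> 0" and y: "y \<in> topspace (P1_Berk v)" "y \<noteq> Some (zeta v a (v c))"
  shows "y \<in> outer a (v c) \<union> (\<Union>b\<in>{b. v (b - a) \<le> v c}. disk b (v c))"
proof (cases y)
  case None
  then show ?thesis by (simp add: outer_def)
next
  case (Some x)
  then have x: "x \<in> A1_Berk v" using y(1) by (auto simp: topspace_P1)
  show ?thesis
  proof (rule ccontr)
    assume "\<not> ?thesis"
    then have 1: "x [:-a, 1:] \<le> v c" and 2: "\<And>b. v (b - a) \<le> v c \<Longrightarrow> v c \<le> x [:-b, 1:]"
      using x Some by (auto simp: outer_def disk_def not_less image_iff)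
    have "x [:-b, 1:] = zeta v a (v c) [:-b, 1:]" for b
    proof (cases "v (a - b) \<le> v c")
      case True
      have "x [:-b, 1:] \<le> max (x [:-a, 1:]) (v (a - b))"
        using A1_add[OF x, of "[:-a, 1:]" "[:a - b:]"] by (simp add: A1_const[OF x])
      moreover have "v c \<le> x [:-b, 1:]" using 2[of b] True v_minus_commute[of a b] by simp
      ultimately show ?thesis using 1 True unfolding zeta_linear[OF c] by linarith
    next
      case False
      have "x ([:-a, 1:] + [:a - b:]) = x [:a - b:]"
        by (rule A1_add_eq[OF x]) (use 1 False in \<open>simp add: A1_const[OF x]\<close>)
      then show ?thesis using False unfolding zeta_linear[OF c] by (simp add: A1_const[OF x])
    qed
    then have "x = zeta v a (v c)" by (intro A1_eqI x zeta_in_A1 c)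
    then show False using y Some by simp
  qed
qed

lemma outer_disk_disjoint: "v (b - a) \<le> r \<Longrightarrow> outer a r \<inter> disk b r = {}"
proof -
  assume ba: "v (b - a) \<le> r"
  have False if "x \<in> A1_Berk v" "r < x [:-a, 1:]" "x [:-b, 1:] < r" for x
    using A1_add[OF that(1), of "[:-b, 1:]" "[:b - a:]"] that ba by (simp add: A1_const)
  then show ?thesis by (auto simp: outer_def disk_def)
qed

text \<open>\<open>outer\<close> and the union of the residue disks are disjoint open sets covering
  the complement of \<xi>, so a connected set through infinity stays in
  \<open>outer\<close>.\<close>

lemma component_subset_outer:
  assumes c: "c \<noteq> 0" and U: "U \<in> complement_components v (Some (zeta v a (v c)))" and "None \<in> U"
  shows "U \<subseteq> outer a (v c)"
proof -
  let ?\<xi> = "Some (zeta v a (v c))"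
  let ?W = "\<Union>b\<in>{b. v (b - a) \<le> v c}. disk b (v c)"
  have "connectedin (subtopology (P1_Berk v) (topspace (P1_Berk v) - {?\<xi>})) U"
    using U unfolding complement_components_def by (rule connectedin_connected_components_of)
  then have con: "connectedin (P1_Berk v) U" and sub: "U \<subseteq> topspace (P1_Berk v) - {?\<xi>}"
    by (auto simp: connectedin_subtopology)
  have W: "openin (P1_Berk v) ?W" using openin_disk by blast
  have cov: "U \<subseteq> outer a (v c) \<union> ?W"
  proof
    fix y assume "y \<in> U"
    then have "y \<in> topspace (P1_Berk v)" "y \<noteq> ?\<xi>" using sub by auto
    then show "y \<in> outer a (v c) \<union> ?W" by (rule complement_zeta_cases[OF c])
  qed
  have dis: "outer a (v c) \<inter> ?W \<inter> U = {}" using outer_disk_disjoint by blast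
  have ne: "outer a (v c) \<inter> U \<noteq> {}" using \<open>None \<in> U\<close> by (auto simp: outer_def)
  have "?W \<inter> U = {}"
    using con openin_outer[of a "v c"] W cov dis ne unfolding connectedin by blast
  then show ?thesis using cov by blast
qed

lemma gnorm_0: "gnorm v 0 f = v (Polynomial.coeff f 0)"
  using gnorm_eqI[of 0 f 0] by (simp add: power_0_left)

text \<open>The Gauss points of growing radius around \<beta> form a path from \<beta> to infinity.
  It misses \<xi>: on z - a its values are at least \<open>v (\<beta> - a)\<close>, while \<xi> has
  the value \<open>v c\<close>.\<close>

lemma type_I_in_component:
  assumes c: "c \<noteq> 0" and U: "U \<in> complement_components v (Some (zeta v a (v c)))" and "None \<in> U"
    and \<beta>: "v c < v (\<beta> - a)"
  shows "type_I v (Some \<beta>) \<in> U"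
proof -
  let ?\<xi> = "Some (zeta v a (v c))" and ?X = "top_of_set (A1_Berk v)"
  define g where "g s f = gnorm v s (pcompose f [:\<beta>, 1:])" for s f
  have gA1: "g s \<in> A1_Berk v" if "0 \<le> s" for s
    unfolding g_def using A1_pcompose[OF gnorm_in_A1[OF that]] .
  have glin: "g s [:-b, 1:] = max (v (\<beta> - b)) s" if "0 \<le> s" for s b
    using that by (simp add: g_def pcompose_pCons gnorm_linear)
  have "continuous_on UNIV g"
    unfolding g_def by (intro continuous_on_coordinatewise_then_product continuous_on_gnorm)
  then have "continuous_on {0..} g" by (rule continuous_on_subset) simp
  then have "connected (g ` {0..})" by (rule connected_continuous_image) simp
  then have "connectedin ?X (g ` {0..})"
    using gA1 by (auto simp: connectedin_subtopology)
  then have path: "connectedin (P1_Berk v) (Some ` g ` {0..})"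
    unfolding P1_Berk_alt by (intro connectedin_continuous_map_image[OF continuous_map_Some])
  \<comment> \<open>A neighborhood of infinity omits only a compact set, on which z - \<beta> is
    bounded; on the path it takes the value \<open>s\<close>.\<close>
  have "None \<in> (P1_Berk v) closure_of (Some ` g ` {0..})"
    unfolding in_closure_of
  proof (intro conjI allI impI)
    show "None \<in> topspace (P1_Berk v)" by (simp add: topspace_P1)
    fix T assume T: "None \<in> T \<and> openin (P1_Berk v) T"
    then obtain C where C: "compactin ?X C" "T = insert None (Some ` (A1_Berk v - C))"
      unfolding P1_Berk_alt openin_Alexandroff_compactification by auto
    have "compact ((\<lambda>x. x [:-\<beta>, 1:]) ` C)"
    proof (rule compact_continuous_image)
      show "continuous_on C (\<lambda>x. x [:-\<beta>, 1:])"
        by (rule continuous_on_subset[OF continuous_on_product_coordinates]) simp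
      show "compact C" using C(1) by (simp add: compactin_subtopology)
    qed
    then obtain B where B: "\<And>x. x \<in> C \<Longrightarrow> \<bar>x [:-\<beta>, 1:]\<bar> \<le> B"
      using compact_imp_bounded bounded_iff by (metis imageI real_norm_def)
    have "g (\<bar>B\<bar> + 1) \<notin> C" using B[of "g (\<bar>B\<bar> + 1)"] by (auto simp: glin)
    then show "\<exists>y. y \<in> Some ` g ` {0..} \<and> y \<in> T"
      using gA1[of "\<bar>B\<bar> + 1"] C(2) by (intro exI[of _ "Some (g (\<bar>B\<bar> + 1))"]) auto
  qed
  then have con: "connectedin (P1_Berk v) (insert None (Some ` g ` {0..}))"
    using path closure_of_subset[OF connectedin_subset_topspace[OF path]]
    by (intro connectedin_intermediate_closure_of[OF path]) auto
  have avoid: "g s \<noteq> zeta v a (v c)" if "0 \<le> s" for s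
  proof
    assume eq: "g s = zeta v a (v c)"
    have "max (v (\<beta> - a)) s = max (v (a - a)) (v c)"
      unfolding glin[OF that, symmetric] zeta_linear[OF c, symmetric] eq ..
    then show False using \<beta> by (auto simp: max_def split: if_splits)
  qed
  have "connectedin (subtopology (P1_Berk v) (topspace (P1_Berk v) - {?\<xi>}))
      (insert None (Some ` g ` {0..}))"
    using con connectedin_subset_topspace[OF con] avoid by (force simp: connectedin_subtopology)
  then have "insert None (Some ` g ` {0..}) \<subseteq> U"
    using U \<open>None \<in> U\<close> unfolding complement_components_def
    by (intro connected_components_of_maximal) (auto simp: disjnt_def)
  moreover have "type_I v (Some \<beta>) = Some (g 0)"
    by (simp add: type_I_def g_def gnorm_0 fun_eq_iff flip: poly_0_coeff_0 add: poly_pcompose)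
  ultimately show ?thesis by auto
qed

end

section \<open>The map near infinity\<close>

lemma comp_num_linear: "comp_num P Q [:b, 1:] = P + Polynomial.smult b Q"
  by (simp add: comp_num_def add.commute)

lemma comp_num_linear': "t \<noteq> 0 \<Longrightarrow> comp_num P Q [:s, t:] = Polynomial.smult s Q + Polynomial.smult t P"
  by (simp add: comp_num_def)

lemma comp_num_const: "comp_num P Q [:s:] = [:s:]"
  by (simp add: comp_num_def)

lemma coeff_pcompose_linear:
  fixes f :: "'c::field poly"
  assumes "Polynomial.degree f \<le> n" "c \<noteq> 0"
  shows "Polynomial.coeff (pcompose f [:a, c:]) n = Polynomial.coeff f n * c ^ n"
proof (cases "Polynomial.degree f = n")
  case True
  then show ?thesis using lead_coeff_comp[of "[:a, c:]" f] assms(2) by (simp add: degree_pcompose)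
next
  case False
  then show ?thesis using assms by (simp add: coeff_eq_0 degree_pcompose)
qed

lemma coeff_mult_top:
  fixes F G :: "'c::comm_semiring_0 poly"
  assumes "Polynomial.degree F \<le> n" "Polynomial.degree G \<le> m"
  shows "Polynomial.coeff (F * G) (n + m) = Polynomial.coeff F n * Polynomial.coeff G m"
proof -
  have "(\<Sum>i\<le>n + m. Polynomial.coeff F i * Polynomial.coeff G (n + m - i)) =
      (\<Sum>i\<in>{n}. Polynomial.coeff F i * Polynomial.coeff G (n + m - i))"
  proof (rule sum.mono_neutral_right)
    show "\<forall>i\<in>{..n + m} - {n}. Polynomial.coeff F i * Polynomial.coeff G (n + m - i) = 0"
    proof
      fix i assume "i \<in> {..n + m} - {n}"
      then have "n < i \<or> m < n + m - i" by auto
      then show "Polynomial.coeff F i * Polynomial.coeff G (n + m - i) = 0"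
        using assms by (auto simp: coeff_eq_0)
    qed
  qed auto
  then show ?thesis by (simp add: coeff_mult)
qed

text \<open>\<open>[:- (a / c), 1 / c:]\<close> is \<open>u\<close> as a polynomial in z; composing
  with it carries polynomials in \<open>u\<close> back to z.\<close>

lemma pcompose_affine_inverse:
  fixes f :: "'c::field poly"
  assumes "c \<noteq> 0"
  shows "pcompose (pcompose f [:a, c:]) [:- (a / c), 1 / c:] = f"
  using assms by (simp add: pcompose_pCons flip: pcompose_assoc)

context nonarch_field
begin

text \<open>In the coordinate \<open>u\<close>, a factor z - y with y in the disk has its norm
  \<open>v c\<close> at the top coefficient \<open>c\<close>, and Gauss's lemma multiplies these. It
  is used contrapositively: a top coefficient that is not maximal produces a root outside the
  disk.\<close>

lemma gnorm_split_in_disk: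
  assumes c: "c \<noteq> 0"
  shows "coeffs_in Kbar f \<Longrightarrow> (\<And>z. z \<in> Kbar \<Longrightarrow> poly f z = 0 \<Longrightarrow> v (z - a) \<le> v c) \<Longrightarrow>
    gnorm v 1 (pcompose f [:a, c:]) =
      v (Polynomial.coeff (pcompose f [:a, c:]) (Polynomial.degree f))"
proof (induction "Polynomial.degree f" arbitrary: f)
  case 0
  then obtain b where "f = [:b:]" by (metis degree_eq_zeroE)
  then show ?case by simp
next
  case (Suc n)
  then obtain z where z: "z \<in> Kbar" "poly f z = 0" using Kbar_root by (metis zero_less_Suc)
  let ?g = "synthetic_div f z"
  have f: "f = [:-z, 1:] * ?g" using synthetic_div_correct'[of z f] z(2) by simp
  have deg: "Polynomial.degree ?g = n" using Suc(2) by (simp add: degree_synthetic_div)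
  have IH: "gnorm v 1 (pcompose ?g [:a, c:]) = v (Polynomial.coeff (pcompose ?g [:a, c:]) n)"
    unfolding deg[symmetric]
  proof (rule Suc(1))
    show "n = Polynomial.degree ?g" using deg by simp
    show "coeffs_in Kbar ?g" using coeffs_in_synthetic_div[OF Kbar_subfield z(1)] Suc(3) by simp
    show "v (y - a) \<le> v c" if "y \<in> Kbar" "poly ?g y = 0" for y
      using Suc(4)[OF that(1)] that(2) by (metis f mult_zero_right poly_mult)
  qed
  have "v (z - a) \<le> v c" using Suc(4) z by blast
  then have lin: "gnorm v 1 (pcompose [:-z, 1:] [:a, c:]) = v c"
    using v_minus_commute[of a z] by (simp add: pcompose_pCons gnorm_linear)
  have pf: "pcompose f [:a, c:] = pcompose [:-z, 1:] [:a, c:] * pcompose ?g [:a, c:]"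
    by (metis f pcompose_mult)
  have "Polynomial.coeff (pcompose f [:a, c:]) (1 + n) =
      Polynomial.coeff (pcompose [:-z, 1:] [:a, c:]) 1 * Polynomial.coeff (pcompose ?g [:a, c:]) n"
    unfolding pf by (rule coeff_mult_top) (use deg c in \<open>simp_all add: degree_pcompose\<close>)
  also have "Polynomial.coeff (pcompose [:-z, 1:] [:a, c:]) 1 = c" by (simp add: pcompose_pCons)
  finally have "v (Polynomial.coeff (pcompose f [:a, c:]) (Polynomial.degree f)) =
      v c * v (Polynomial.coeff (pcompose ?g [:a, c:]) n)"
    using Suc(2) by (simp add: v_mult)
  moreover have "gnorm v 1 (pcompose f [:a, c:]) =
      v c * v (Polynomial.coeff (pcompose ?g [:a, c:]) n)"
    unfolding pf by (simp only: gnorm_mult[OF zero_le_one] lin IH)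
  ultimately show ?case by simp
qed

end

text \<open>In the coordinate \<open>u = (z - a) / c\<close>, the map \<open>P / Q\<close> becomes \<open>A / B\<close>.\<close>

locale affine_coordinate = nonarch_field v K Kbar
  for v :: "'c::field \<Rightarrow> real" and K Kbar +
  fixes a c :: 'c and P Q A B :: "'c poly" and d :: nat
  assumes c: "c \<noteq> 0"
    and d: "d = rat_degree P Q" "1 \<le> d"
  defines "A \<equiv> Polynomial.smult (inverse c) (pcompose (P - Polynomial.smult a Q) [:a, c:])"
    and "B \<equiv> pcompose Q [:a, c:]"
begin

lemma degree_PQ: "Polynomial.degree P \<le> d" "Polynomial.degree Q \<le> d"
  by (simp_all add: d rat_degree_def)

lemma degree_A: "Polynomial.degree A \<le> d" and degree_B: "Polynomial.degree B \<le> d"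
proof -
  have "Polynomial.degree (P - Polynomial.smult a Q) \<le> d"
    using degree_PQ by (intro degree_diff_le) (auto intro: order_trans[OF degree_smult_le])
  then show "Polynomial.degree A \<le> d"
    using c by (simp add: A_def degree_pcompose)
  show "Polynomial.degree B \<le> d" using degree_PQ c by (simp add: B_def degree_pcompose)
qed

lemma coeff_A_d: "Polynomial.coeff A d = (Polynomial.coeff P d - a * Polynomial.coeff Q d) * c ^ d / c"
proof -
  have "Polynomial.degree (P - Polynomial.smult a Q) \<le> d"
    using degree_PQ by (intro degree_diff_le) (auto intro: order_trans[OF degree_smult_le])
  from coeff_pcompose_linear[OF this c, of a] show ?thesis
    unfolding A_def by (simp add: divide_inverse)
qed

lemma coeff_B_d: "Polynomial.coeff B d = Polynomial.coeff Q d * c ^ d"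
  unfolding B_def by (rule coeff_pcompose_linear[OF degree_PQ(2) c])

lemma poly_Q_affine: "poly Q (a + c * u) = poly B u"
  by (simp add: B_def poly_pcompose mult.commute)

lemma poly_P_affine: "poly P (a + c * u) = a * poly B u + c * poly A u"
  using c by (simp add: A_def B_def poly_pcompose mult.commute field_simps)

lemma pcompose_A_back: "pcompose A [:- (a / c), 1 / c:] = Polynomial.smult (inverse c) (P - Polynomial.smult a Q)"
  unfolding A_def pcompose_smult pcompose_affine_inverse[OF c] ..

lemma pcompose_B_back: "pcompose B [:- (a / c), 1 / c:] = Q"
  unfolding B_def pcompose_affine_inverse[OF c] ..

text \<open>At \<xi> the polynomial z - a has value \<open>v c\<close>, so fixedness gives
  \<open>P - a Q\<close> the value \<open>v c\<close> times that of \<open>Q\<close>; the factor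
  \<open>inverse c\<close> in \<open>A\<close> absorbs the \<open>v c\<close>. If \<open>Q\<close>
  vanished at \<xi>, the image would be infinity.\<close>

lemma fixed_imp_gnorm_eq:
  assumes "berk_map v P Q (Some (zeta v a (v c))) = Some (zeta v a (v c))"
  shows "gnorm v 1 A = gnorm v 1 B" "0 < gnorm v 1 B"
proof -
  let ?z = "zeta v a (v c)"
  have zQ: "?z Q \<noteq> 0" and fx: "\<And>f. ?z (comp_num P Q f) / ?z Q ^ Polynomial.degree f = ?z f"
    using assms by (auto simp: berk_map_def fun_eq_iff split: if_splits)
  have zQ': "?z Q = gnorm v 1 B" by (simp add: zeta_eq_gnorm[OF c] B_def)
  have "?z (P - Polynomial.smult a Q) = v c * ?z Q"
    using fx[of "[:-a, 1:]"] zQ zeta_linear[OF c, of a a]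
    by (simp add: comp_num_linear field_simps max_absorb2)
  moreover have "gnorm v 1 A = inverse (v c) * ?z (P - Polynomial.smult a Q)"
    unfolding A_def zeta_eq_gnorm[OF c] using A1_smult[OF gnorm_in_A1[of 1]] by (simp add: v_inverse)
  ultimately show "gnorm v 1 A = gnorm v 1 B" using c zQ' by simp
  show "0 < gnorm v 1 B" using zQ zQ' gnorm_nonneg[of 1 B] by simp
qed

lemma rat_at_infinity_cases:
  obtains "rat_at_infinity P Q = None" "Polynomial.coeff Q d = 0" "Polynomial.coeff P d \<noteq> 0"
  | "rat_at_infinity P Q = Some (Polynomial.coeff P d / Polynomial.coeff Q d)" "Polynomial.coeff Q d \<noteq> 0"
proof (cases "Polynomial.degree Q < Polynomial.degree P")
  case True
  then have "d = Polynomial.degree P" by (simp add: d rat_degree_def)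
  moreover have "P \<noteq> 0" using True by auto
  ultimately show ?thesis using True that(1) by (simp add: rat_at_infinity_def coeff_eq_0)
next
  case False
  then have dq: "d = Polynomial.degree Q" by (simp add: d rat_degree_def)
  then have "Q \<noteq> 0" using d(2) by auto
  then show ?thesis using False that(2) dq by (simp add: rat_at_infinity_def)
qed

text \<open>The direction of infinity is not a bad direction: otherwise it would contain a preimage
  of \<open>a\<close>.\<close>

lemma infinity_good_direction:
  assumes fixed: "berk_map v P Q (Some (zeta v a (v c))) = Some (zeta v a (v c))"
    and cop: "coprime P Q" and PQ: "coeffs_in Kbar P" "coeffs_in Kbar Q" and a: "a \<in> Kbar"
    and U: "U \<subseteq> outer a (v c)" "berk_map v P Q ` U \<subseteq> U" "None \<in> U"
    and UI: "\<And>\<beta>. v c < v (\<beta> - a) \<Longrightarrow> type_I v (Some \<beta>) \<in> U"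
  shows "v (Polynomial.coeff A d) = gnorm v 1 B" "v (Polynomial.coeff B d) < gnorm v 1 B"
proof -
  note g = fixed_imp_gnorm_eq[OF fixed]
  have inf: "type_I v (rat_at_infinity P Q) \<in> outer a (v c)"
    using U by (force simp: berk_map_def)
  \<comment> \<open>The image of infinity lies outside the disk and so differs from
    \<open>a\<close>. This fixes the degree of \<open>P - a Q\<close> as \<open>d\<close>, the index
    at which \<open>gnorm_split_in_disk\<close> looks.\<close>
  have A0: "Polynomial.coeff A d \<noteq> 0"
    by (cases rule: rat_at_infinity_cases)
      (use inf c in \<open>auto simp: coeff_A_d outer_def type_I_def leD[OF v_nonneg]\<close>)
  show Ad: "v (Polynomial.coeff A d) = gnorm v 1 B"
  proof (rule ccontr)
    assume ne: "v (Polynomial.coeff A d) \<noteq> gnorm v 1 B"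
    define f where "f = P - Polynomial.smult a Q"
    have A: "A = Polynomial.smult (inverse c) (pcompose f [:a, c:])" by (simp add: A_def f_def)
    have "Polynomial.degree f = d"
    proof (rule antisym)
      show "Polynomial.degree f \<le> d" unfolding f_def
        using degree_PQ by (intro degree_diff_le) (auto intro: order_trans[OF degree_smult_le])
      show "d \<le> Polynomial.degree f" using A0 by (intro le_degree) (auto simp: f_def coeff_A_d)
    qed
    moreover have "gnorm v 1 A = inverse (v c) * gnorm v 1 (pcompose f [:a, c:])"
      unfolding A using A1_smult[OF gnorm_in_A1[of 1]] by (simp add: v_inverse)
    ultimately have "gnorm v 1 (pcompose f [:a, c:]) \<noteq>
        v (Polynomial.coeff (pcompose f [:a, c:]) (Polynomial.degree f))"
      using ne g(1) unfolding A by (auto simp: v_mult v_inverse)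
    moreover have "coeffs_in Kbar f"
      unfolding f_def by (intro coeffs_in_closed[OF Kbar_subfield] PQ a)
    ultimately obtain \<beta> where \<beta>: "poly f \<beta> = 0" "v c < v (\<beta> - a)"
      using gnorm_split_in_disk[OF c] by (metis not_le)
    have P: "poly P \<beta> = a * poly Q \<beta>" using \<beta>(1) by (simp add: f_def)
    have "poly Q \<beta> \<noteq> 0"
    proof
      assume "poly Q \<beta> = 0"
      then show False using P coprime_poly_0[OF cop, of \<beta>] by simp
    qed
    then have "Some (\<lambda>f. v (poly (comp_num P Q f) \<beta>) / v (poly Q \<beta>) ^ Polynomial.degree f) \<in> outer a (v c)"
      using UI[OF \<beta>(2)] U by (force simp: berk_map_def type_I_def)
    then have "v c < v (poly (comp_num P Q [:-a, 1:]) \<beta>) / v (poly Q \<beta>)"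
      by (auto simp: outer_def)
    then show False using P v_nonneg[of c] by (simp add: comp_num_linear)
  qed
  \<comment> \<open>Either infinity is a fixed point and the coefficient is 0, or A_d / B_d is the
    \<open>u\<close>-coordinate of its image, which has size greater than 1.\<close>
  show "v (Polynomial.coeff B d) < gnorm v 1 B"
  proof (cases rule: rat_at_infinity_cases)
    case 1
    then show ?thesis using g by (simp add: coeff_B_d)
  next
    case 2
    have lt: "v c < v (Polynomial.coeff P d / Polynomial.coeff Q d - a)"
      using inf 2 by (auto simp: outer_def type_I_def)
    have "Polynomial.coeff A d = Polynomial.coeff B d *
        ((Polynomial.coeff P d / Polynomial.coeff Q d - a) / c)"
    proof -
      define w where "w = Polynomial.coeff P d / Polynomial.coeff Q d - a"
      have "Polynomial.coeff P d - a * Polynomial.coeff Q d = Polynomial.coeff Q d * w"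
        using 2 by (simp add: w_def right_diff_distrib mult.commute)
      then show ?thesis unfolding coeff_A_d coeff_B_d w_def[symmetric] by (simp add: mult_ac)
    qed
    then have "v (Polynomial.coeff A d) = v (Polynomial.coeff B d) *
        (v (Polynomial.coeff P d / Polynomial.coeff Q d - a) / v c)"
      by (simp only: v_mult v_divide)
    moreover have "v (Polynomial.coeff B d) * 1 < \<dots>"
      using lt c 2 by (intro mult_strict_left_mono) (auto simp: v_pos coeff_B_d)
    ultimately show ?thesis using Ad by simp
  qed
qed

text \<open>The size at \<open>\<eta>\<close> of a form of degree \<open>n\<close>, given by its dehomogenization in \<open>u\<close> and normalized
  by \<open>u ^ n\<close>; this treats \<open>\<infinity>\<close> on an equal footing with the other points near it.\<close>

definition form_norm :: "('c poly \<Rightarrow> real) option \<Rightarrow> nat \<Rightarrow> 'c poly \<Rightarrow> real" where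
  "form_norm \<eta> n F = (case \<eta> of None \<Rightarrow> v (Polynomial.coeff F n)
    | Some x \<Rightarrow> x (pcompose F [:- (a / c), 1 / c:]) / x [:- (a / c), 1 / c:] ^ n)"

lemma outer_Some:
  assumes "Some x \<in> outer a (v c)"
  shows "x \<in> A1_Berk v" "1 < x [:- (a / c), 1 / c:]"
proof -
  show x: "x \<in> A1_Berk v" using assms by (auto simp: outer_def)
  have "[:- (a / c), 1 / c:] = Polynomial.smult (inverse c) [:-a, 1:]" by (simp add: divide_inverse mult.commute)
  then have "x [:- (a / c), 1 / c:] = x [:-a, 1:] / v c"
    by (simp only: A1_smult[OF x] v_inverse) (simp add: divide_inverse mult.commute)
  then show "1 < x [:- (a / c), 1 / c:]" using assms c by (auto simp: outer_def v_pos)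
qed

lemma form_norm_dominant:
  assumes \<eta>: "\<eta> \<in> outer a (v c)" and "Polynomial.degree F \<le> n"
    "\<And>i. v (Polynomial.coeff F i) \<le> v (Polynomial.coeff F n)"
  shows "form_norm \<eta> n F = v (Polynomial.coeff F n)"
proof (cases \<eta>)
  case (Some x)
  note x = outer_Some[OF \<eta>[unfolded Some]]
  have "x (pcompose F [:- (a / c), 1 / c:]) = v (Polynomial.coeff F n) * x [:- (a / c), 1 / c:] ^ n"
    using A1_dominant[OF A1_pcompose[OF x(1), of "[:- (a / c), 1 / c:]"] _ assms(2,3)] x(2)
    by (simp add: pcompose_pCons)
  then show ?thesis using x(2) Some by (simp add: form_norm_def)
qed (simp add: form_norm_def)

lemma form_norm_mult:
  assumes "\<eta> \<in> outer a (v c)" "Polynomial.degree F \<le> n" "Polynomial.degree G \<le> m"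
  shows "form_norm \<eta> (n + m) (F * G) = form_norm \<eta> n F * form_norm \<eta> m G"
proof (cases \<eta>)
  case None
  then show ?thesis using assms by (simp add: form_norm_def coeff_mult_top v_mult)
next
  case (Some x)
  then show ?thesis using outer_Some(1)[of x] assms(1)
    by (simp add: form_norm_def pcompose_mult A1_mult power_add)
qed

text \<open>The form s + t u pulls back to (s B + t A) / B and the normalizing u to A / B, so
  \<open>B\<close> cancels. What remains is divided by |A|, which is M |u|^d because
  \<open>A\<close> has a dominant top coefficient.\<close>

lemma form_norm_image:
  assumes \<eta>: "\<eta> \<in> outer a (v c)" and M: "v (Polynomial.coeff A d) = M" "0 < M"
    and A: "\<And>i. v (Polynomial.coeff A i) \<le> M"
  shows "form_norm (berk_map v P Q \<eta>) 1 [:s, t:] =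
    form_norm \<eta> d (Polynomial.smult t A + Polynomial.smult s B) / M"
proof -
  have pL: "pcompose [:s, t:] [:- (a / c), 1 / c:] = [:s - t * a / c, t / c:]"
    by (simp add: pcompose_pCons)
  show ?thesis
  proof (cases \<eta>)
    case None
    show ?thesis
    proof (cases rule: rat_at_infinity_cases)
      case 1
      then show ?thesis
        using M None by (simp add: form_norm_def berk_map_def type_I_def coeff_B_d v_mult)
    next
      case 2
      define u where "u = Polynomial.coeff A d / Polynomial.coeff B d"
      have Bd: "Polynomial.coeff B d \<noteq> 0" using 2 c by (simp add: coeff_B_d)
      have Ad: "Polynomial.coeff A d = u * Polynomial.coeff B d" using Bd by (simp add: u_def)
      have u: "(Polynomial.coeff P d / Polynomial.coeff Q d - a) / c = u"
        using 2 c by (simp add: u_def coeff_A_d coeff_B_d field_simps)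
      have u0: "u \<noteq> 0" using M Ad by auto
      let ?g = "Polynomial.coeff P d / Polynomial.coeff Q d"
      have "form_norm (berk_map v P Q \<eta>) 1 [:s, t:] =
          v (poly [:s - t * a / c, t / c:] ?g) / v (poly [:- (a / c), 1 / c:] ?g)"
        using None 2 by (simp only: form_norm_def berk_map_def type_I_def option.case option.map pL power_one_right)
      also have "poly [:s - t * a / c, t / c:] ?g = s + t * u"
        unfolding u[symmetric] using c by (simp add: field_simps)
      also have "poly [:- (a / c), 1 / c:] ?g = u"
        unfolding u[symmetric] using c by (simp add: field_simps)
      also have "v (s + t * u) / v u = v (t * Polynomial.coeff A d + s * Polynomial.coeff B d) / M"
      proof -
        have "t * Polynomial.coeff A d + s * Polynomial.coeff B d = (s + t * u) * Polynomial.coeff B d"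
          by (simp add: Ad algebra_simps)
        then show ?thesis using M(1) Bd unfolding Ad by (auto simp: v_mult)
      qed
      finally show ?thesis using None by (simp add: form_norm_def)
    qed
  next
    case (Some x)
    note x = outer_Some[OF \<eta>[unfolded Some]]
    let ?b = "\<lambda>F. pcompose F [:- (a / c), 1 / c:]"
    let ?R = "x [:- (a / c), 1 / c:]"
    have xA: "x (?b A) = M * ?R ^ d"
      using form_norm_dominant[OF \<eta> degree_A] A M x(2) Some by (simp add: form_norm_def field_simps)
    show ?thesis
    proof (cases "x Q = 0")
      \<comment> \<open>At a pole the \<open>B\<close> term vanishes and the quotient is
        \<open>v t\<close>, the size of the form at infinity.\<close>
      case True
      have "x (?b (Polynomial.smult t A + Polynomial.smult s B)) = v t * x (?b A)"
      proof -
        have sB: "x (Polynomial.smult s Q) = 0" by (simp add: A1_smult[OF x(1)] True)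
        have "x (Polynomial.smult t (?b A) + Polynomial.smult s Q) = x (Polynomial.smult t (?b A))"
          using A1_add[OF x(1), of "Polynomial.smult t (?b A)" "Polynomial.smult s Q"]
            A1_diff[OF x(1), of "Polynomial.smult t (?b A) + Polynomial.smult s Q" "Polynomial.smult s Q"]
            A1_nonneg[OF x(1)] sB
          by (simp add: antisym)
        then show ?thesis
          by (simp add: pcompose_add pcompose_smult pcompose_B_back A1_smult[OF x(1)])
      qed
      then show ?thesis using True Some xA x(2) M by (simp add: form_norm_def berk_map_def)
    next
      case False
      let ?y = "\<lambda>f. x (comp_num P Q f) / x Q ^ Polynomial.degree f"
      have y: "?y [:s - t * a / c, t / c:] = x (?b (Polynomial.smult t A + Polynomial.smult s B)) / x Q"
        for s t
      proof (cases "t = 0")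
        case True
        then show ?thesis using False
          by (simp add: comp_num_const A1_const[OF x(1)] pcompose_smult pcompose_B_back A1_smult[OF x(1)])
      next
        case False
        then have tc: "t / c \<noteq> 0" using c by simp
        have "?b (Polynomial.smult t A + Polynomial.smult s B)
            = Polynomial.smult (t / c) P + Polynomial.smult (s - t * a / c) Q"
          unfolding pcompose_add pcompose_smult pcompose_A_back pcompose_B_back
          by (simp add: smult_diff_right smult_diff_left divide_inverse algebra_simps)
        then show ?thesis unfolding comp_num_linear'[OF tc] using tc by (simp add: add.commute)
      qed
      have y1: "?y [:- (a / c), 1 / c:] = x (?b A) / x Q" using y[of 0 1] by simp
      have "form_norm (berk_map v P Q \<eta>) 1 [:s, t:] =
          ?y [:s - t * a / c, t / c:] / ?y [:- (a / c), 1 / c:]"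
        using False Some by (simp only: form_norm_def berk_map_def option.case pL power_one_right if_False)
      also have "\<dots> = x (?b (Polynomial.smult t A + Polynomial.smult s B)) / x (?b A)"
        unfolding y y1 using False by simp
      finally show ?thesis using Some by (simp add: form_norm_def xA)
    qed
  qed
qed

text \<open>The hypotheses say that the reduction of \<open>A / B\<close> fixes infinity with
  nonzero multiplier. Points with equal images give every combination of \<open>A\<close> and
  \<open>B\<close> the same form norm. The combination vanishing at a given u is a linear form times
  a cofactor of constant form norm on \<open>outer\<close>, so the linear forms agree too, and they
  determine the point.\<close>

lemma inj_on_outer:
  assumes g: "gnorm v 1 A = M" "gnorm v 1 B = M" "0 < M"
    and Ad: "v (Polynomial.coeff A d) = M" and Bd: "v (Polynomial.coeff B d) < M"
    and Bd1: "v (Polynomial.coeff B (d - 1)) = M"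
  shows "inj_on (berk_map v P Q) (outer a (v c))"
proof (rule inj_onI)
  fix \<eta> \<theta> assume \<eta>: "\<eta> \<in> outer a (v c)" and \<theta>: "\<theta> \<in> outer a (v c)"
    and eq: "berk_map v P Q \<eta> = berk_map v P Q \<theta>"
  have leA: "v (Polynomial.coeff A i) \<le> M" and leB: "v (Polynomial.coeff B i) \<le> M" for i
    using gnorm_ge[of 1 A i] gnorm_ge[of 1 B i] g by auto
  obtain k where k: "d = Suc k" using d(2) by (cases d) auto
  have forms: "form_norm \<eta> d (Polynomial.smult t A + Polynomial.smult s B) =
      form_norm \<theta> d (Polynomial.smult t A + Polynomial.smult s B)" for s t
    using form_norm_image[OF \<eta> Ad g(3) leA, of s t] form_norm_image[OF \<theta> Ad g(3) leA, of s t] eq g(3)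
    by simp
  have cancel: "form_norm \<eta> 1 L = form_norm \<theta> 1 L"
    if F: "Polynomial.smult t A + Polynomial.smult s B = L * G"
      and L: "Polynomial.degree L \<le> 1" and G: "Polynomial.degree G \<le> k"
      "\<And>i. v (Polynomial.coeff G i) \<le> v (Polynomial.coeff G k)" "Polynomial.coeff G k \<noteq> 0"
    for s t L G
  proof -
    have "form_norm \<zeta> d (L * G) = form_norm \<zeta> 1 L * v (Polynomial.coeff G k)"
      if "\<zeta> \<in> outer a (v c)" for \<zeta>
      using form_norm_mult[OF that L G(1)] form_norm_dominant[OF that G(1,2)] k by simp
    then show ?thesis using forms[of t s] \<eta> \<theta> G(3) unfolding F by simp
  qed
  \<comment> \<open>The combination vanishing at infinity: the terms of degree \<open>d\<close>
    cancel. The next coefficient is A_d B_k - B_d A_k, whose first term dominates because |B_d| < M.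
    The linear form at infinity is 1, so the cofactor is \<open>H\<close> itself.\<close>
  define H where "H = Polynomial.smult (Polynomial.coeff A d) B + Polynomial.smult (- Polynomial.coeff B d) A"
  have H: "Polynomial.degree H \<le> k" "v (Polynomial.coeff H k) = M * M"
    "v (Polynomial.coeff H i) \<le> M * M" for i
  proof -
    show "Polynomial.degree H \<le> k"
    proof (rule degree_le, intro allI impI)
      fix i assume "k < i"
      then consider "i = d" | "d < i" using k by linarith
      then show "Polynomial.coeff H i = 0"
        using degree_A degree_B by cases (auto simp: H_def coeff_eq_0 algebra_simps)
    qed
    have "v (Polynomial.coeff B d * Polynomial.coeff A k) < M * M"
      using Bd leA[of k] g(3) unfolding v_mult
      by (metis mult_left_mono mult_strict_right_mono order_le_less_trans v_nonneg)
    then have "v (Polynomial.coeff B d * Polynomial.coeff A k) < v (Polynomial.coeff A d * Polynomial.coeff B k)"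
      using Ad Bd1 k by (simp add: v_mult)
    from v_diff_eq[OF this] show "v (Polynomial.coeff H k) = M * M"
      using Ad Bd1 k v_minus_commute by (simp add: H_def v_mult)
    have "v (Polynomial.coeff A d * Polynomial.coeff B i) \<le> M * M"
      "v (Polynomial.coeff B d * Polynomial.coeff A i) \<le> M * M"
      unfolding v_mult using leA leB g(3) by (intro mult_mono; simp)+
    then show "v (Polynomial.coeff H i) \<le> M * M"
      using v_diff_le[of "Polynomial.coeff A d * Polynomial.coeff B i" "Polynomial.coeff B d * Polynomial.coeff A i"]
      by (simp add: H_def)
  qed
  have one: "form_norm \<eta> 1 [:1:] = form_norm \<theta> 1 [:1:]"
  proof (rule cancel[of "- Polynomial.coeff B d" "Polynomial.coeff A d" "[:1:]" H])
    show "Polynomial.coeff H k \<noteq> 0" using H(2) g(3) by auto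
  qed (use H in \<open>auto simp: H_def add.commute\<close>)
  have lin: "form_norm \<eta> 1 [:-u, 1:] = form_norm \<theta> 1 [:-u, 1:]" for u
  proof (cases "v u \<le> 1")
    case True
    have "form_norm \<zeta> 1 [:-u, 1:] = 1" if "\<zeta> \<in> outer a (v c)" for \<zeta>
      using form_norm_dominant[OF that, of "[:-u, 1:]" 1] True by (auto simp: coeff_pCons split: nat.split)
    then show ?thesis using \<eta> \<theta> by simp
  next
    case False
    then have u: "1 < v u" by simp
    define F where "F = Polynomial.smult (poly B u) A + Polynomial.smult (- poly A u) B"
    define G where "G = synthetic_div F u"
    have FG: "F = [:-u, 1:] * G" using synthetic_div_correct'[of u F] by (simp add: F_def G_def)
    have dF: "Polynomial.degree F \<le> d" unfolding F_def
      using degree_A degree_B by (intro degree_add_le) (auto intro: order_trans[OF degree_smult_le])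
    then have dG: "Polynomial.degree G \<le> k" using k by (simp add: G_def degree_synthetic_div)
    have "Polynomial.coeff ([:-u, 1:] * G) (1 + k) = Polynomial.coeff [:-u, 1:] 1 * Polynomial.coeff G k"
      by (rule coeff_mult_top) (use dG in auto)
    then have "Polynomial.coeff G k = Polynomial.coeff F d" unfolding FG[symmetric] using k by simp
    \<comment> \<open>F_d is B(u) A_d - A(u) B_d, hence the dominant term of \<open>H\<close>
      computes its size exactly.\<close>
    also have "\<dots> = poly H u" by (simp add: F_def H_def algebra_simps)
    finally have "v (Polynomial.coeff G k) = v (poly H u)" by simp
    also have "\<dots> = M * M * v u ^ k"
      using v_poly_dominant[OF u H(1)] H(2,3) by simp
    finally have Gk: "v (Polynomial.coeff G k) = M * M * v u ^ k" .
    have bound: "v (poly f u) \<le> M * v u ^ d" if "Polynomial.degree f \<le> d" "\<And>i. v (Polynomial.coeff f i) \<le> M" for f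
    proof -
      obtain i where i: "i \<le> Polynomial.degree f" "gnorm v (v u) f = v (Polynomial.coeff f i) * v u ^ i"
        using gnorm_attained by blast
      have "v (poly f u) \<le> gnorm v (v u) f" using A1_le_gnorm[OF eval_in_A1, of u "v u" f] by simp
      also have "\<dots> \<le> M * v u ^ d"
        unfolding i(2) using that(1) i(1) that(2)[of i] u g(3) by (intro mult_mono power_increasing) auto
      finally show ?thesis .
    qed
    \<comment> \<open>The linear factor has Gauss norm |u|; dividing it out of this bound leaves
      exactly the size of G_k, so the top coefficient of the cofactor is maximal.\<close>
    have "gnorm v 1 F \<le> max (v (poly B u) * M) (v (poly A u) * M)"
      unfolding F_def using A1_diff[OF gnorm_in_A1[of 1], of "Polynomial.smult (poly B u) A" "Polynomial.smult (poly A u) B"]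
        A1_smult[OF gnorm_in_A1[of 1]] g by simp
    also have "\<dots> \<le> (M * v u ^ d) * M"
      using bound[OF degree_A leA] bound[OF degree_B leB] g(3) by (intro max.boundedI mult_right_mono) auto
    finally have "v u * gnorm v 1 G \<le> M * v u ^ d * M"
      unfolding FG using u gnorm_linear[of 1 "-u" 1] by (simp only: gnorm_mult[OF zero_le_one]) simp
    then have "gnorm v 1 G \<le> M * M * v u ^ k"
      using u k by (simp add: mult_ac)
    then have "v (Polynomial.coeff G i) \<le> v (Polynomial.coeff G k)" for i
      using gnorm_ge[of 1 G i] unfolding Gk by simp
    moreover have "Polynomial.coeff G k \<noteq> 0" using Gk g(3) u by auto
    ultimately show ?thesis
      by (intro cancel[of "poly B u" "- poly A u" _ G]) (use FG dG in \<open>auto simp: F_def\<close>)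
  qed
  show "\<eta> = \<theta>"
  proof (cases \<eta>; cases \<theta>)
    fix x y assume xy: "\<eta> = Some x" "\<theta> = Some y"
    note x = outer_Some[OF \<eta>[unfolded xy]] and y = outer_Some[OF \<theta>[unfolded xy]]
    \<comment> \<open>The form 1 in degree 1 has norm 1 / |u|, so \<open>one\<close> allows the
      normalization to be dropped. At infinity its norm is 0, which separates infinity from all
      other points in the last cases.\<close>
    have R: "x [:- (a / c), 1 / c:] = y [:- (a / c), 1 / c:]"
      using one x y xy by (simp add: form_norm_def A1_const)
    have "x [:-b, 1:] = y [:-b, 1:]" for b
    proof -
      let ?L = "pcompose [:- ((b - a) / c), 1:] [:- (a / c), 1 / c:]"
      have "x ?L = y ?L" using lin[of "(b - a) / c"] R x(2) xy by (simp add: form_norm_def)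
      moreover have "[:-b, 1:] = Polynomial.smult c ?L"
        using c by (simp add: pcompose_pCons field_simps)
      ultimately show ?thesis by (simp only: A1_smult[OF x(1)] A1_smult[OF y(1)])
    qed
    then show ?thesis unfolding xy by (simp add: A1_eqI[OF x(1) y(1)])
  next
    fix x assume "\<eta> = None" "\<theta> = Some x"
    then show ?thesis using one outer_Some[of x] \<theta> by (auto simp: form_norm_def A1_const coeff_pCons)
  next
    fix x assume "\<eta> = Some x" "\<theta> = None"
    then show ?thesis using one outer_Some[of x] \<eta> by (auto simp: form_norm_def A1_const coeff_pCons)
  qed auto
qed

end

section \<open>A polynomial over \<open>K\<close> with all roots in the disk\<close>

definition reverse_poly :: "nat \<Rightarrow> 'c::field poly \<Rightarrow> 'c poly" where
  "reverse_poly n f = (\<Sum>i\<le>n. Polynomial.monom (Polynomial.coeff f (n - i)) i)"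

lemma coeff_reverse_poly:
  "Polynomial.coeff (reverse_poly n f) i = (if i \<le> n then Polynomial.coeff f (n - i) else 0)"
  unfolding reverse_poly_def by (simp add: coeff_sum if_distrib cong: if_cong)

lemma poly_reverse_poly:
  fixes w :: "'c::field"
  assumes "w \<noteq> 0" "Polynomial.degree f \<le> n"
  shows "poly (reverse_poly n f) w = w ^ n * poly f (1 / w)"
proof -
  have "poly f (1 / w) = (\<Sum>i\<le>n. Polynomial.coeff f i * (1 / w) ^ i)"
    by (subst poly_as_sum_of_monoms'[OF assms(2), symmetric]) (simp add: poly_sum poly_monom)
  then have "w ^ n * poly f (1 / w) = (\<Sum>i\<le>n. Polynomial.coeff f i * w ^ (n - i))"
    using assms(1) by (simp add: sum_distrib_left power_diff power_divide mult_ac cong: sum.cong_simp)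
  also have "\<dots> = (\<Sum>i\<le>n. Polynomial.coeff f (n - i) * w ^ i)"
    by (rule sum.reindex_bij_witness[of _ "\<lambda>i. n - i" "\<lambda>i. n - i"]) auto
  finally show ?thesis by (simp add: reverse_poly_def poly_sum poly_monom)
qed

text \<open>The k-th derivative divided by k!, given by coefficients because k! may vanish in the
  field.\<close>

definition hasse_deriv :: "nat \<Rightarrow> 'c::field poly \<Rightarrow> 'c poly" where
  "hasse_deriv k f = (\<Sum>i\<le>Polynomial.degree f.
    Polynomial.monom (of_nat ((i + k) choose k) * Polynomial.coeff f (i + k)) i)"

lemma coeff_hasse_deriv:
  "Polynomial.coeff (hasse_deriv k f) i = of_nat ((i + k) choose k) * Polynomial.coeff f (i + k)"
  unfolding hasse_deriv_def by (simp add: coeff_sum if_distrib coeff_eq_0 cong: if_cong)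

lemma hasse_deriv_linear:
  "hasse_deriv k (f + g) = hasse_deriv k f + hasse_deriv k g"
  "hasse_deriv k (Polynomial.smult b f) = Polynomial.smult b (hasse_deriv k f)"
  by (auto intro!: poly_eqI simp: coeff_hasse_deriv algebra_simps)

lemma hasse_deriv_0: "hasse_deriv 0 f = f"
  by (rule poly_eqI) (simp add: coeff_hasse_deriv)

lemma hasse_deriv_pCons:
  "hasse_deriv (Suc k) (pCons b f) = hasse_deriv k f + pCons 0 (hasse_deriv (Suc k) f)"
proof (rule poly_eqI)
  fix i
  show "Polynomial.coeff (hasse_deriv (Suc k) (pCons b f)) i =
      Polynomial.coeff (hasse_deriv k f + pCons 0 (hasse_deriv (Suc k) f)) i"
    by (cases i) (simp_all add: coeff_hasse_deriv binomial_eq_0 algebra_simps)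
qed

lemma hasse_deriv_mult_linear:
  "hasse_deriv (Suc k) ([:a, c:] * g) =
    Polynomial.smult c (hasse_deriv k g) + [:a, c:] * hasse_deriv (Suc k) g"
proof -
  have L: "[:a, c:] * h = Polynomial.smult a h + Polynomial.smult c (pCons 0 h)" for h by simp
  show ?thesis
    unfolding L hasse_deriv_linear hasse_deriv_pCons by (simp add: smult_add_right)
qed

text \<open>Chain rule for an affine substitution, by induction along the Horner scheme with the
  product rule above. The derivative can thus be formed over \<open>K\<close> in z and estimated in
  \<open>u\<close>.\<close>

lemma hasse_deriv_pcompose_linear:
  "hasse_deriv k (pcompose f [:a, c:]) = Polynomial.smult (c ^ k) (pcompose (hasse_deriv k f) [:a, c:])"
proof (induction f arbitrary: k)
  case 0
  then show ?case by (simp add: hasse_deriv_def)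
next
  case (pCons b f)
  show ?case
  proof (cases k)
    case 0
    then show ?thesis by (simp add: hasse_deriv_0)
  next
    case (Suc m)
    have "hasse_deriv (Suc m) [:b:] = 0" by (rule poly_eqI) (simp add: coeff_hasse_deriv coeff_pCons)
    then show ?thesis
      unfolding Suc pcompose_pCons hasse_deriv_linear hasse_deriv_mult_linear pCons.IH hasse_deriv_pCons
      by (simp add: pcompose_add pcompose_pCons smult_add_right mult_smult_right)
  qed
qed

section \<open>Contraction near an attracting fixed point\<close>

context nonarch_abs
begin

lemma v_power_diff_le:
  assumes "v x \<le> \<mu>" "v y \<le> \<mu>"
  shows "v (x ^ Suc n - y ^ Suc n) \<le> v (x - y) * \<mu> ^ n"
proof -
  have \<mu>: "0 \<le> \<mu>" using assms(1) v_nonneg[of x] by linarith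
  have "v (\<Sum>i<Suc n. x ^ i * y ^ (n - i)) \<le> \<mu> ^ n"
  proof (rule v_sum_le)
    fix i assume "i \<in> {..<Suc n}"
    then have "\<mu> ^ n = \<mu> ^ i * \<mu> ^ (n - i)" by (simp flip: power_add)
    moreover have "v x ^ i * v y ^ (n - i) \<le> \<mu> ^ i * \<mu> ^ (n - i)"
      using assms \<mu> by (intro mult_mono power_mono) auto
    ultimately show "v (x ^ i * y ^ (n - i)) \<le> \<mu> ^ n" by (simp add: v_mult v_power)
  qed (use \<mu> in simp)
  then show ?thesis
    unfolding diff_power_eq_sum v_mult by (rule mult_left_mono) simp
qed

lemma v_poly_diff_le:
  assumes "v x \<le> \<mu>" "v y \<le> \<mu>" "0 \<le> L" and "\<And>i. v (Polynomial.coeff f (Suc i)) * \<mu> ^ i \<le> L"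
  shows "v (poly f x - poly f y) \<le> L * v (x - y)"
proof -
  have "poly f x - poly f y = (\<Sum>i\<le>Polynomial.degree f. Polynomial.coeff f i * (x ^ i - y ^ i))"
    by (simp add: poly_altdef right_diff_distrib sum_subtractf)
  also have "v \<dots> \<le> L * v (x - y)"
  proof (rule v_sum_le)
    fix i
    show "v (Polynomial.coeff f i * (x ^ i - y ^ i)) \<le> L * v (x - y)"
    proof (cases i)
      case (Suc n)
      have "v (Polynomial.coeff f i * (x ^ i - y ^ i)) \<le> v (Polynomial.coeff f i) * (v (x - y) * \<mu> ^ n)"
        using v_power_diff_le[OF assms(1,2), of n] Suc by (simp add: v_mult mult_left_mono)
      also have "\<dots> = (v (Polynomial.coeff f (Suc n)) * \<mu> ^ n) * v (x - y)" by (simp add: Suc mult_ac)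
      also have "\<dots> \<le> L * v (x - y)" using assms(4)[of n] by (rule mult_right_mono) simp
      finally show ?thesis .
    qed (use assms(3) in simp)
  qed (use assms(3) in simp)
  finally show ?thesis .
qed

text \<open>On |w| \<le> \<mu> the denominator has constant size M, and numerator and its variation
  are smaller by the factor \<mu>, so the quotient maps this disk into itself and contracts by
  \<mu>. All steps after the first are shorter than |w 1|, which freezes |w n|.\<close>

lemma iterates_of_contraction:
  assumes \<mu>: "0 \<le> \<mu>" "\<mu> < 1" and M: "0 < M"
    and \<alpha>: "v (Polynomial.coeff \<alpha> 0) = M" "\<And>i. v (Polynomial.coeff \<alpha> i) \<le> M"
    and \<beta>: "v (Polynomial.coeff \<beta> 0) \<le> \<mu> * M" "v (Polynomial.coeff \<beta> 1) \<le> \<mu> * M"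
      "\<And>i. v (Polynomial.coeff \<beta> i) \<le> M"
    and w: "w 0 = 0" "\<And>n. w (Suc n) = poly \<beta> (w n) / poly \<alpha> (w n)"
  shows "v (poly \<alpha> (w n)) = M" "v (w (Suc n) - w n) \<le> \<mu> ^ n * v (w 1)"
    "1 \<le> n \<Longrightarrow> v (w n) = v (w 1)"
proof -
  have const: "poly f x = Polynomial.coeff f 0 + x * poly (poly_shift 1 f) x" for f x
  proof -
    have "f = pCons (Polynomial.coeff f 0) (poly_shift 1 f)"
      by (rule poly_eqI) (simp add: coeff_poly_shift coeff_pCons split: nat.split)
    then show ?thesis by (metis poly_pCons)
  qed
  have tail: "v (x * poly (poly_shift 1 f) x) \<le> \<mu> * M"
    if "v x \<le> \<mu>" "\<And>i. v (Polynomial.coeff f i) \<le> M" for f x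
  proof -
    have "v (poly (poly_shift 1 f) x) \<le> gnorm v 1 (poly_shift 1 f)"
      using that \<mu> by (intro v_poly_le) simp
    also have "\<dots> \<le> M" using that(2) by (intro gnorm_le) (simp add: coeff_poly_shift)
    finally show ?thesis unfolding v_mult using that(1) \<mu> by (intro mult_mono) auto
  qed
  have va: "v (poly \<alpha> x) = M" if x: "v x \<le> \<mu>" for x
  proof -
    have "v (x * poly (poly_shift 1 \<alpha>) x) < v (Polynomial.coeff \<alpha> 0)"
      using tail[OF x \<alpha>(2)] \<mu> M \<alpha>(1) by (smt (verit) mult_less_cancel_right2)
    from v_add_eq[OF this] show ?thesis using const[of \<alpha> x] \<alpha>(1) by (simp add: add.commute)
  qed
  have vb: "v (poly \<beta> x) \<le> \<mu> * M" if x: "v x \<le> \<mu>" for x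
    using v_ultrametric[of "Polynomial.coeff \<beta> 0" "x * poly (poly_shift 1 \<beta>) x"]
      tail[OF x \<beta>(3)] \<beta>(1) const[of \<beta> x] by simp
  have small: "v (w n) \<le> \<mu>" for n
  proof (induction n)
    case (Suc n)
    then show ?case using va[OF Suc] vb[OF Suc] M by (simp add: w v_divide pos_divide_le_eq)
  qed (use w \<mu> in simp)
  show vaw: "v (poly \<alpha> (w n)) = M" for n by (rule va[OF small])
  have contract: "v (w (Suc (Suc n)) - w (Suc n)) \<le> \<mu> * v (w (Suc n) - w n)" for n
  proof -
    let ?x = "w (Suc n)" and ?y = "w n"
    let ?N = "(poly \<beta> ?x - poly \<beta> ?y) * poly \<alpha> ?y - poly \<beta> ?y * (poly \<alpha> ?x - poly \<alpha> ?y)"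
    have ne: "poly \<alpha> ?x \<noteq> 0" "poly \<alpha> ?y \<noteq> 0" using vaw[of "Suc n"] vaw[of n] M by auto
    have "w (Suc (Suc n)) - w (Suc n) = ?N / (poly \<alpha> ?x * poly \<alpha> ?y)"
      unfolding w(2)[of "Suc n"] using ne by (subst (2) w(2)) (simp add: field_simps)
    then have eq: "v (w (Suc (Suc n)) - w (Suc n)) = v ?N / (M * M)"
      by (simp only: v_divide v_mult vaw)
    have "v (poly \<beta> ?x - poly \<beta> ?y) \<le> (\<mu> * M) * v (?x - ?y)"
    proof (rule v_poly_diff_le[OF small small])
      \<comment> \<open>The linear coefficient is small by assumption; the higher ones gain a factor
        \<mu> from the radius.\<close>
      fix i
      show "v (Polynomial.coeff \<beta> (Suc i)) * \<mu> ^ i \<le> \<mu> * M"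
      proof (cases i)
        case (Suc m)
        have "\<mu> ^ i \<le> \<mu>" using \<mu> Suc by (simp add: mult_left_le power_le_one)
        then have "v (Polynomial.coeff \<beta> (Suc i)) * \<mu> ^ i \<le> M * \<mu>"
          using \<beta>(3) M \<mu> by (intro mult_mono) auto
        then show ?thesis by (simp add: mult.commute)
      qed (use \<beta>(2) in simp)
    qed (use \<mu> M in simp)
    then have 1: "v ((poly \<beta> ?x - poly \<beta> ?y) * poly \<alpha> ?y) \<le> (\<mu> * M) * v (?x - ?y) * M"
      unfolding v_mult vaw using M by (intro mult_right_mono) auto
    have "v (poly \<alpha> ?x - poly \<alpha> ?y) \<le> M * v (?x - ?y)"
    proof (rule v_poly_diff_le[OF small small])
      fix i
      have "v (Polynomial.coeff \<alpha> (Suc i)) * \<mu> ^ i \<le> M * 1"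
        using \<alpha>(2) M \<mu> by (intro mult_mono power_le_one) auto
      then show "v (Polynomial.coeff \<alpha> (Suc i)) * \<mu> ^ i \<le> M" by simp
    qed (use M in simp)
    then have 2: "v (poly \<beta> ?y * (poly \<alpha> ?x - poly \<alpha> ?y)) \<le> (\<mu> * M) * (M * v (?x - ?y))"
      unfolding v_mult using vb[OF small] \<mu> M by (intro mult_mono) auto
    have "v ?N \<le> \<mu> * v (?x - ?y) * (M * M)"
      using v_diff_le[of "(poly \<beta> ?x - poly \<beta> ?y) * poly \<alpha> ?y" "poly \<beta> ?y * (poly \<alpha> ?x - poly \<alpha> ?y)"] 1 2
      by (simp add: mult_ac)
    then show ?thesis unfolding eq using M by (simp add: pos_divide_le_eq)
  qed
  show step: "v (w (Suc n) - w n) \<le> \<mu> ^ n * v (w 1)" for n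
  proof (induction n)
    case (Suc n)
    have "v (w (Suc (Suc n)) - w (Suc n)) \<le> \<mu> * (\<mu> ^ n * v (w 1))"
      using order_trans[OF contract mult_left_mono[OF Suc \<mu>(1)]] .
    then show ?case by (simp add: mult.assoc)
  qed (simp add: w(1))
  show "v (w n) = v (w 1)" if "1 \<le> n"
  proof (cases "w 1 = 0")
    case True
    have "w (Suc m) = 0" for m
    proof (induction m)
      case (Suc m)
      have "v (w (Suc (Suc m)) - w (Suc m)) \<le> 0" using step[of "Suc m"] True by simp
      then have "v (w (Suc (Suc m)) - w (Suc m)) = 0" by (rule antisym) (rule v_nonneg)
      then show ?case using Suc by simp
    qed (use True in simp)
    then show ?thesis using that by (cases n) auto
  next
    case False
    have "v (w n - w 1) \<le> \<mu> * v (w 1)"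
      using that
    proof (induction n rule: dec_induct)
      case (step n)
      have "\<mu> ^ n \<le> \<mu> ^ 1" using step(1) \<mu> by (intro power_decreasing) auto
      then have "\<mu> ^ n * v (w 1) \<le> \<mu> * v (w 1)" by (intro mult_right_mono) auto
      then have "v (w (Suc n) - w n) \<le> \<mu> * v (w 1)" using \<open>\<And>n. v (w (Suc n) - w n) \<le> \<mu> ^ n * v (w 1)\<close> order_trans by blast
      then show ?case using v_ultrametric[of "w (Suc n) - w n" "w n - w 1"] step.IH by simp
    qed (use \<mu> in simp)
    also have "\<dots> < v (w 1)" using \<mu> False v_pos[of "w 1"] by simp
    finally show ?thesis using v_add_eq[of "w n - w 1" "w 1"] by simp
  qed
qed

end

section \<open>The fixed-point polynomial and its quotient over K\<close>

context affine_coordinate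
begin

lemma pcompose_fixed_point_poly:
  "pcompose (P - pCons 0 Q) [:a, c:] = Polynomial.smult c (A - pCons 0 B)"
proof -
  have "Polynomial.smult c A = pcompose P [:a, c:] - Polynomial.smult a B"
    using c by (simp add: A_def B_def pcompose_diff pcompose_smult)
  moreover have "[:a, c:] * B = Polynomial.smult a B + Polynomial.smult c (pCons 0 B)" by simp
  ultimately show ?thesis
    by (simp add: pcompose_diff pcompose_pCons smult_diff_right flip: B_def)
qed

text \<open>The fixed-point polynomial \<open>P - z Q\<close> has degree \<open>d + 1\<close> and just one root near \<open>\<infinity>\<close>, the
  attracting fixed point. As \<open>K\<close> need not be complete, that root may not lie in \<open>K\<close>; but the orbit
  of \<open>\<infinity>\<close> converges to it inside \<open>K\<close>, and dividing by \<open>z - x\<close>, with remainder, for \<open>x\<close> far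
  out in this orbit has the same effect.\<close>

lemma K_poly_with_dominant_top:
  assumes PQ: "coeffs_in K P" "coeffs_in K Q"
    and g: "gnorm v 1 A = M" "gnorm v 1 B = M" "0 < M"
    and Ad: "v (Polynomial.coeff A d) = M" and Bd: "v (Polynomial.coeff B d) < M"
    and Bd1: "v (Polynomial.coeff B (d - 1)) < M"
  obtains f where "coeffs_in K f" "Polynomial.degree f \<le> d" "Polynomial.coeff (pcompose f [:a, c:]) d \<noteq> 0"
    "\<And>i. v (Polynomial.coeff (pcompose f [:a, c:]) i) \<le> v (Polynomial.coeff (pcompose f [:a, c:]) d)"
proof -
  note K = subfield_closed[OF K_subfield]
  have leA: "v (Polynomial.coeff A i) \<le> M" and leB: "v (Polynomial.coeff B i) \<le> M" for i
    using gnorm_ge[of 1 A i] gnorm_ge[of 1 B i] g by auto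
  obtain k where k: "d = Suc k" using d(2) by (cases d) auto
  define \<Phi> where "\<Phi> = P - pCons 0 Q"
  have \<Phi>K: "coeffs_in K \<Phi>" unfolding \<Phi>_def by (intro coeffs_in_closed[OF K_subfield] PQ K)
  have d\<Phi>: "Polynomial.degree \<Phi> \<le> Suc d" unfolding \<Phi>_def
    using degree_PQ by (intro degree_diff_le) (auto intro: order_trans[OF degree_pCons_le])
  have T\<Phi>: "pcompose \<Phi> [:a, c:] = Polynomial.smult c (A - pCons 0 B)"
    unfolding \<Phi>_def by (rule pcompose_fixed_point_poly)
  have le\<Phi>: "v (Polynomial.coeff (A - pCons 0 B) i) \<le> M" for i
    using v_diff_le[of "Polynomial.coeff A i" "Polynomial.coeff (pCons 0 B) i"] leA[of i] leB g(3)
    by (auto simp: coeff_pCons split: nat.splits intro: order_trans)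
  show ?thesis
  proof (cases "Polynomial.coeff B d = 0")
    \<comment> \<open>Infinity is itself the fixed point, so the fixed-point polynomial already has
      degree \<open>d\<close> and nothing is divided out.\<close>
    case True
    then have Qd: "Polynomial.coeff Q d = 0" using c by (simp add: coeff_B_d)
    have "Polynomial.degree \<Phi> \<le> d"
    proof (rule degree_le, intro allI impI)
      fix i assume "d < i"
      then show "Polynomial.coeff \<Phi> i = 0"
        using degree_PQ Qd by (cases "i = Suc d") (auto simp: \<Phi>_def coeff_eq_0 coeff_pCons split: nat.split)
    qed
    moreover have top: "v (Polynomial.coeff (A - pCons 0 B) d) = M"
      using v_diff_eq[of "Polynomial.coeff B k" "Polynomial.coeff A d"] Bd1 Ad k v_minus_commute
      by (simp add: coeff_pCons)
    moreover have "Polynomial.coeff (A - pCons 0 B) d \<noteq> 0" using top g(3) by (metis v_0 less_irrefl)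
    moreover have "v (Polynomial.coeff (pcompose \<Phi> [:a, c:]) i)
        \<le> v (Polynomial.coeff (pcompose \<Phi> [:a, c:]) d)" for i
      unfolding T\<Phi> coeff_smult v_mult top using le\<Phi> by (intro mult_left_mono) auto
    ultimately show ?thesis
      using that[of \<Phi>] \<Phi>K c unfolding T\<Phi> coeff_smult by simp
  next
    case False
    \<comment> \<open>Contraction factor in the coordinate w = 1 / u: there the map is the quotient
      of the reversed polynomials, so B_d and B_(d-1) become the constant and the linear coefficient
      of the numerator. Infinity is w = 0, where the orbit starts.\<close>
    define \<mu> where "\<mu> = max (v (Polynomial.coeff B d)) (v (Polynomial.coeff B k)) / M"
    have \<mu>: "0 < \<mu>" "\<mu> < 1" "v (Polynomial.coeff B d) \<le> \<mu> * M" "v (Polynomial.coeff B k) \<le> \<mu> * M"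
      using Bd Bd1 k g(3) v_pos[OF False] by (auto simp: \<mu>_def less_max_iff_disj)
    let ?\<alpha> = "reverse_poly d A" and ?\<beta> = "reverse_poly d B"
    define w where "w n = rec_nat 0 (\<lambda>_ x. poly ?\<beta> x / poly ?\<alpha> x) n" for n
    have w: "w 0 = 0" "w (Suc n) = poly ?\<beta> (w n) / poly ?\<alpha> (w n)" for n by (simp_all add: w_def)
    have it: "v (poly ?\<alpha> (w n)) = M" "v (w (Suc n) - w n) \<le> \<mu> ^ n * v (w 1)"
      "1 \<le> n \<Longrightarrow> v (w n) = v (w 1)" for n
      by (rule iterates_of_contraction[where \<alpha> = ?\<alpha> and \<beta> = ?\<beta> and \<mu> = \<mu> and M = M];
          use \<mu> g(3) Ad leA leB w k in \<open>force simp: coeff_reverse_poly\<close>)+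
    have Ad0: "Polynomial.coeff A d \<noteq> 0" using Ad g(3) by auto
    have w1: "w 1 = Polynomial.coeff B d / Polynomial.coeff A d"
      using w(2)[of 0] w(1) by (simp add: poly_0_coeff_0 coeff_reverse_poly)
    then have w10: "w 1 \<noteq> 0" using False Ad0 by simp
    have wn0: "w n \<noteq> 0" if "1 \<le> n" for n using it(3)[OF that] w10 by (metis v_eq_0_iff)
    have rev: "poly ?\<alpha> (w n) = w n ^ d * poly A (1 / w n)" "poly ?\<beta> (w n) = w n ^ d * poly B (1 / w n)"
      if "1 \<le> n" for n
      using poly_reverse_poly[OF wn0[OF that]] degree_A degree_B by auto
    \<comment> \<open>This is the n-th image of infinity under \<open>P / Q\<close>, hence in
      \<open>K\<close> although \<open>a\<close> and \<open>c\<close> need not be.\<close>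
    have zK: "a + c / w n \<in> K" if "1 \<le> n" for n
      using that
    proof (induction n rule: dec_induct)
      case base
      have "a + c / w 1 = Polynomial.coeff P d / Polynomial.coeff Q d"
        unfolding w1 coeff_A_d using False c by (simp add: coeff_B_d field_simps)
      then show ?case using PQ K by (simp add: coeffs_in_def)
    next
      case (step n)
      let ?u = "1 / w n"
      have ws: "w (Suc n) = poly B ?u / poly A ?u"
        using w(2)[of n] wn0[OF step(1)] by (simp add: rev[OF step(1)])
      then have ne: "poly B ?u \<noteq> 0" "poly A ?u \<noteq> 0" using wn0[of "Suc n"] by auto
      have "a + c / w (Suc n) = poly P (a + c * ?u) / poly Q (a + c * ?u)"
        unfolding poly_P_affine poly_Q_affine ws using ne by (simp add: field_simps)
      then show ?case
        using step.IH PQ K coeffs_in_closed(6)[OF K_subfield] by simp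
    qed
    \<comment> \<open>The remainder must not exceed |c| M. Clearing denominators costs |w 1|^(d+1),
      and the step length already supplies one factor |w 1|.\<close>
    obtain n0 where n0: "\<mu> ^ n0 < v (w 1) ^ d"
      using real_arch_pow_inv[of "v (w 1) ^ d" \<mu>] \<mu>(2) v_pos[OF w10] by auto
    define n where "n = Suc n0"
    have n1: "1 \<le> n" by (simp add: n_def)
    have "\<mu> ^ n \<le> \<mu> ^ n0" unfolding n_def using \<mu> by (intro power_decreasing) auto
    then have n: "\<mu> ^ n \<le> v (w 1) ^ d" using n0 by linarith
    define u where "u = 1 / w n"
    define z where "z = a + c * u"
    have zK: "z \<in> K" using zK[OF n1] by (simp add: z_def u_def)
    have vu: "v u = 1 / v (w 1)" using it(3)[OF n1] by (simp add: u_def v_divide)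
    have small: "v (poly A u - u * poly B u) \<le> M"
    proof -
      have "w n ^ Suc d * (poly A u - u * poly B u) = w n * poly ?\<alpha> (w n) - poly ?\<beta> (w n)"
        unfolding rev[OF n1] u_def using wn0[OF n1] by (simp add: algebra_simps)
      also have "\<dots> = poly ?\<alpha> (w n) * (w n - w (Suc n))"
        using it(1)[of n] g(3) unfolding w(2)[of n] by (cases "poly ?\<alpha> (w n) = 0") (auto simp: algebra_simps)
      finally have "v (w n ^ Suc d * (poly A u - u * poly B u)) = v (poly ?\<alpha> (w n) * (w n - w (Suc n)))"
        by simp
      then have "v (w 1) ^ Suc d * v (poly A u - u * poly B u) = M * v (w (Suc n) - w n)"
        unfolding v_mult v_power it(3)[OF n1] it(1) using v_minus_commute[of "w n" "w (Suc n)"] by simp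
      also have "\<dots> \<le> M * (v (w 1) ^ d * v (w 1))"
        using it(2)[of n] n g(3) by (intro mult_left_mono order_trans[OF it(2)] mult_right_mono) auto
      finally have "v (w 1) ^ Suc d * v (poly A u - u * poly B u) \<le> v (w 1) ^ Suc d * M"
        by (simp add: mult_ac)
      then show ?thesis using v_pos[OF w10] by (simp add: mult_le_cancel_left)
    qed
    have \<Phi>z: "poly \<Phi> z = c * (poly A u - u * poly B u)"
      unfolding \<Phi>_def z_def by (simp add: poly_P_affine poly_Q_affine algebra_simps)
    define f where "f = synthetic_div \<Phi> z"
    let ?Tf = "pcompose f [:a, c:]"
    have df: "Polynomial.degree f \<le> d" using d\<Phi> by (simp add: f_def degree_synthetic_div)
    have "\<Phi> = [:-z, 1:] * f + [:poly \<Phi> z:]" using synthetic_div_correct'[of z \<Phi>] by (simp add: f_def)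
    then have "pcompose \<Phi> [:a, c:] = pcompose [:-z, 1:] [:a, c:] * ?Tf + [:poly \<Phi> z:]"
      by (metis pcompose_add pcompose_mult pcompose_const)
    also have "pcompose [:-z, 1:] [:a, c:] = Polynomial.smult c [:-u, 1:]"
      by (simp add: pcompose_pCons z_def)
    finally have T: "Polynomial.smult c (A - pCons 0 B) - [:poly \<Phi> z:] = Polynomial.smult c ([:-u, 1:] * ?Tf)"
      unfolding T\<Phi> by (simp add: smult_diff_right)
    \<comment> \<open>Gauss's lemma for dividend minus remainder: the quotient has norm at most M /
      |u| = M |w 1| = |B_d|.\<close>
    have "v c * (max (v u) 1 * gnorm v 1 ?Tf) = gnorm v 1 (Polynomial.smult c (A - pCons 0 B) - [:poly \<Phi> z:])"
      unfolding T A1_smult[OF gnorm_in_A1[OF zero_le_one]] gnorm_mult[OF zero_le_one]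
      using gnorm_linear[of 1 "-u" 1] by simp
    also have "\<dots> \<le> max (v c * gnorm v 1 (A - pCons 0 B)) (v (poly \<Phi> z))"
      using A1_diff[OF gnorm_in_A1[OF zero_le_one], of "Polynomial.smult c (A - pCons 0 B)" "[:poly \<Phi> z:]"]
      unfolding A1_smult[OF gnorm_in_A1[OF zero_le_one]] by simp
    also have "\<dots> \<le> v c * M"
      unfolding \<Phi>z v_mult using small le\<Phi> by (intro max.boundedI mult_left_mono gnorm_le) auto
    finally have "max (v u) 1 * gnorm v 1 ?Tf \<le> M" using c by (simp add: v_pos)
    then have "v u * gnorm v 1 ?Tf \<le> M"
      using mult_right_mono[of "v u" "max (v u) 1" "gnorm v 1 ?Tf"] gnorm_nonneg[of 1 ?Tf] by simp
    then have "gnorm v 1 ?Tf \<le> M * v (w 1)"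
      using v_pos[OF w10] unfolding vu by (simp add: field_simps)
    also have "\<dots> = v (Polynomial.coeff B d)" unfolding w1 v_divide Ad using g(3) by simp
    finally have gf: "gnorm v 1 ?Tf \<le> v (Polynomial.coeff B d)" .
    \<comment> \<open>The constant remainder does not touch index \<open>d + 1\<close>, so the top
      coefficient of the quotient is -B_d and attains the bound just found.\<close>
    have prod: "Polynomial.coeff ([:-u, 1:] * ?Tf) (1 + d) = Polynomial.coeff [:-u, 1:] 1 * Polynomial.coeff ?Tf d"
      by (rule coeff_mult_top) (use df c in \<open>simp_all add: degree_pcompose\<close>)
    have "Polynomial.coeff (Polynomial.smult c (A - pCons 0 B) - [:poly \<Phi> z:]) (1 + d) =
        - (c * Polynomial.coeff B d)"
      using degree_A by (simp add: coeff_eq_0)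
    then have "c * Polynomial.coeff ?Tf d = - (c * Polynomial.coeff B d)"
      unfolding T coeff_smult prod by simp
    then have top: "Polynomial.coeff ?Tf d = - Polynomial.coeff B d"
      using c by (metis mult_minus_right mult_left_cancel)
    show ?thesis
    proof (rule that[of f])
      show "coeffs_in K f" unfolding f_def by (rule coeffs_in_synthetic_div[OF K_subfield zK \<Phi>K])
      show "v (Polynomial.coeff ?Tf i) \<le> v (Polynomial.coeff ?Tf d)" for i
        using gnorm_ge[of 1 ?Tf i] gf by (simp add: top)
    qed (use df top False in auto)
  qed
qed

end

context nonarch_field
begin

text \<open>The divided derivative of order d - q multiplies the top coefficient by a unit and the
  others by elements of size at most 1. The top stays maximal, so no root lies outside the disk; a
  root exists because q >= 1.\<close>

lemma hasse_deriv_root_in_disk: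
  assumes c: "c \<noteq> 0" and f: "coeffs_in K f" "Polynomial.degree f \<le> d"
    and top: "Polynomial.coeff (pcompose f [:a, c:]) d \<noteq> 0"
    and dom: "\<And>i. v (Polynomial.coeff (pcompose f [:a, c:]) i) \<le> v (Polynomial.coeff (pcompose f [:a, c:]) d)"
    and q: "1 \<le> q" "q \<le> d" "v (of_nat (d choose q)) = 1"
  obtains \<alpha> where "\<alpha> \<in> Kbar" "v (\<alpha> - a) \<le> v c" "degree_le K (Some \<alpha>) q"
proof -
  define k where "k = d - q"
  have dk: "d = q + k" using q by (simp add: k_def)
  have ch: "v (of_nat ((q + k) choose k)) = 1" using q binomial_symmetric[of q d] by (simp add: k_def)
  let ?T = "pcompose f [:a, c:]"
  have fd: "Polynomial.coeff f d \<noteq> 0" using top coeff_pcompose_linear[OF f(2) c, of a] by auto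
  define g where "g = hasse_deriv k f"
  have "Polynomial.coeff g q \<noteq> 0" using fd ch dk by (auto simp: g_def coeff_hasse_deriv)
  then have gne: "g \<noteq> 0" and qg: "q \<le> Polynomial.degree g" by (auto intro: le_degree)
  have dT: "Polynomial.degree (hasse_deriv k h) \<le> q" if "Polynomial.degree h \<le> d" for h :: "'c poly"
    by (rule degree_le) (use that dk in \<open>auto simp: coeff_hasse_deriv coeff_eq_0\<close>)
  have gK: "coeffs_in K g"
    using f(1) subfield_closed[OF K_subfield] by (simp add: coeffs_in_def g_def coeff_hasse_deriv)
  obtain \<alpha> where \<alpha>: "\<alpha> \<in> Kbar" "poly g \<alpha> = 0"
    using Kbar_root[OF coeffs_in_mono[OF gK K_subset_Kbar]] q(1) qg by auto
  have "v (\<alpha> - a) \<le> v c"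
  proof (rule ccontr)
    assume "\<not> v (\<alpha> - a) \<le> v c"
    then have u: "1 < v ((\<alpha> - a) / c)" using c by (simp add: v_divide v_pos)
    have topq: "v (Polynomial.coeff (hasse_deriv k ?T) q) = v (Polynomial.coeff ?T d)"
      using ch by (simp add: coeff_hasse_deriv v_mult dk)
    have "v (poly (hasse_deriv k ?T) ((\<alpha> - a) / c)) =
        v (Polynomial.coeff (hasse_deriv k ?T) q) * v ((\<alpha> - a) / c) ^ q"
    proof (rule v_poly_dominant[OF u])
      show "Polynomial.degree (hasse_deriv k ?T) \<le> q" using f(2) c by (intro dT) (simp add: degree_pcompose)
      fix i
      have "v (of_nat (i + k choose k)) * v (Polynomial.coeff ?T (i + k)) \<le> 1 * v (Polynomial.coeff ?T d)"
        using v_of_nat_le dom by (intro mult_mono) auto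
      then show "v (Polynomial.coeff (hasse_deriv k ?T) i) \<le> v (Polynomial.coeff (hasse_deriv k ?T) q)"
        unfolding topq by (simp add: coeff_hasse_deriv v_mult)
    qed
    moreover have "poly (hasse_deriv k ?T) ((\<alpha> - a) / c) = 0"
      using \<alpha>(2) c by (simp add: hasse_deriv_pcompose_linear poly_pcompose flip: g_def)
    ultimately show False using top topq u by auto
  qed
  moreover have "degree_le K (Some \<alpha>) q"
    using degree_le_root[OF K_subfield gK gne \<alpha>(2) dT[OF f(2), folded g_def]] .
  ultimately show ?thesis using that \<alpha>(1) by blast
qed

end

theorem theorem3p2:
  fixes v :: "'c::field \<Rightarrow> real" and K Kbar :: "'c set"
    and P Q :: "'c poly" and d p e :: nat
    and \<xi> :: "('c poly \<Rightarrow> real) option" and U :: "('c poly \<Rightarrow> real) option set"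
  assumes "nonarch_field v K Kbar"
    and "p = residue_char v K"
    and "\<forall>i. Polynomial.coeff P i \<in> K" and "\<forall>i. Polynomial.coeff Q i \<in> K" and "coprime P Q"
    and "d = rat_degree P Q" and "d \<ge> 2"
    and "is_type_II v \<xi>" and "totally_invariant v P Q \<xi>"
    and "e = multiplicity p d"
    and "attracting_fixed_component v P Q \<xi> U"
    and "U \<inter> type_I v ` proj_line K \<noteq> {}"
  shows "\<exists>\<alpha>\<in>proj_line Kbar. type_I v \<alpha> \<notin> U \<and> degree_le K \<alpha> (p ^ e)"
proof -
  interpret nonarch_field v K Kbar by fact
  have q: "p ^ e \<le> d" "1 \<le> p ^ e" "v (of_nat (d choose p ^ e)) = 1"
    using v_choose_prime_power_multiplicity[of d] assms(2,7,10) by auto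
  show ?thesis
  proof (cases "None \<in> U")
    case False
    then show ?thesis
      using degree_le_infinity[OF K_subfield q(2)]
      by (intro bexI[of _ None]) (auto simp: type_I_def proj_line_def)
  next
    case True
    obtain a0 c where c: "c \<noteq> 0" and \<xi>0: "\<xi> = Some (zeta v a0 (v c))"
      using assms(8) by (auto simp: is_type_II_def)
    \<comment> \<open>The center is moved into \<open>Kbar\<close> so that \<open>P - a Q\<close>
      has coefficients there and its roots can be found.\<close>
    obtain a where a: "a \<in> Kbar" "v (a0 - a) < v c" using Kbar_approx[of "v c" a0] v_pos[OF c] by blast
    have \<xi>: "\<xi> = Some (zeta v a (v c))" using \<xi>0 zeta_recenter[of a0 a "v c"] a(2) by simp
    define A where "A = Polynomial.smult (inverse c) (pcompose (P - Polynomial.smult a Q) [:a, c:])"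
    define B where "B = pcompose Q [:a, c:]"
    interpret affine_coordinate v K Kbar a c P Q A B d
      by unfold_locales (use c assms(6,7) A_def B_def in auto)
    have PQ: "coeffs_in K P" "coeffs_in K Q" using assms(3,4) by (auto simp: coeffs_in_def)
    have fixed: "berk_map v P Q (Some (zeta v a (v c))) = Some (zeta v a (v c))"
      using assms(9) unfolding totally_invariant_def \<xi> by blast
    have U: "U \<in> complement_components v (Some (zeta v a (v c)))" "berk_map v P Q ` U \<subseteq> U"
      "\<not> inj_on (berk_map v P Q) U"
      using assms(11) unfolding attracting_fixed_component_def \<xi> by auto
    have out: "U \<subseteq> outer a (v c)" by (rule component_subset_outer[OF c U(1) True])
    note g = fixed_imp_gnorm_eq[OF fixed]
    have top: "v (Polynomial.coeff A d) = gnorm v 1 B" "v (Polynomial.coeff B d) < gnorm v 1 B"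
      using infinity_good_direction[OF fixed assms(5) coeffs_in_mono[OF PQ(1) K_subset_Kbar]
          coeffs_in_mono[OF PQ(2) K_subset_Kbar] a(1) out U(2) True type_I_in_component[OF c U(1) True]]
      by auto
    \<comment> \<open>The only use of attracting: equality would make the map injective on
      \<open>outer\<close>, hence on U.\<close>
    have "v (Polynomial.coeff B (d - 1)) \<noteq> gnorm v 1 B"
      using inj_on_outer[OF g(1) refl g(2) top] inj_on_subset[OF _ out] U(3) by blast
    then have Bd1: "v (Polynomial.coeff B (d - 1)) < gnorm v 1 B"
      using gnorm_ge[of 1 B "d - 1"] by simp
    obtain f where f: "coeffs_in K f" "Polynomial.degree f \<le> d"
      "Polynomial.coeff (pcompose f [:a, c:]) d \<noteq> 0"
      "\<And>i. v (Polynomial.coeff (pcompose f [:a, c:]) i) \<le> v (Polynomial.coeff (pcompose f [:a, c:]) d)"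
      using K_poly_with_dominant_top[OF PQ g(1) refl g(2) top Bd1] by blast
    obtain \<alpha> where \<alpha>: "\<alpha> \<in> Kbar" "v (\<alpha> - a) \<le> v c" "degree_le K (Some \<alpha>) (p ^ e)"
      using hasse_deriv_root_in_disk[OF c f q(2,1,3)] by blast
    have "type_I v (Some \<alpha>) \<notin> U"
      using out \<alpha>(2) by (auto simp: type_I_def outer_def)
    then show ?thesis using \<alpha> by (intro bexI[of _ "Some \<alpha>"]) (auto simp: proj_line_def)
  qed
qed

end
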